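(* Let $(X_1,Y_1),\dots,(X_n,Y_n)$ be i.i.d. with distribution $F=P_{\theta_0}$ on $\mathcal{X}\times\mathcal{Y}\subset\mathbb{R}^p\times\mathbb{R}$, let $L:(\mathcal{X}\times\mathcal{Y})\times\Theta\to[0,\infty[$ be a loss function with derivative $\varphi=\partial_\theta L$, let $J_\lambda:\Theta\to[0,\infty[$ be a penalty with derivative $J_\lambda'$, and set $$\varphi^\lambda((x,y),\theta)=\varphi((x,y),\theta)+J_\lambda'(\theta),\qquad \eta^\lambda(\theta)=\int\varphi((x,y),\theta)\,dF(x,y)+J_\lambda'(\theta),$$ $$Z_n^\lambda(\theta)=\frac1n\sum_{i=1}^n\varphi((X_i,Y_i),\theta)+J_\lambda'(\theta).$$ Assume: (i) the parametric model $\mathcal{P}=\{P_\theta \mid \theta\in\Theta\}$ is $L_2$-differentiable, and if $\psi_\theta$ is an influence curve, then it belongs to $\Psi_2(\theta)$; (ii) $\Theta\subset\mathbb{R}^p$ is nonempty, compact and equals the topological closure of its interior; (iii) $\varphi^\lambda(\cdot,\theta)\in L_2^p(F)$ for all $\theta\in\Theta$; (iv) there is $\theta_0\in\Theta^\circ$ with $\eta^\lambda(\theta_0)=0$, and $\eta^\lambda$ is locally homeomorphic at $\theta_0$ with bounded and invertible derivative $d\eta^\lambda(\theta_0)$; (v) $J_\lambda$ is non-negative and convex with $J_\lambda(0_p)=0$; (vi) the learning procedure is $\sqrt n$-consistent (for $\theta_0$); (vii) the function $Z_n^\lambda$ is twice differentiable with respect to $\theta$. Then the sequence $(S_n^\lambda)_n:=(T\circ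 Z_n^\lambda)_n$ of regularized M-estimators is asymptotically linear.
   Context: $p$ is finite. The underlying model is linear regression: $Y=f_\theta(X)+\epsilon$ with $f_\theta(X)=X\theta$, where the errors are i.i.d. with mean $0$ and variance in $]0,\infty[$; $L((x,y),\theta)$ is short for $L((x,y),f_\theta)$, and integration and differentiation in $\theta$ are interchangeable. $\mathcal{C}^p(\Theta)$ is the space of continuous $\mathbb{R}^p$-valued functions on $\Theta$ with the supremum norm. $L_2^p(F)$ is the space of $\mathbb{R}^p$-valued functions square-integrable with respect to $F$. $L_2$-differentiability: $\mathcal{P}$ is $L_2$-differentiable at $\theta_0$ if there is $\Lambda_{\theta_0}\in L_2^p(P_{\theta_0})$ with $\|\sqrt{dP_{\theta_0+h}}-\sqrt{dP_{\theta_0}}(1+\tfrac12h^T\Lambda_{\theta_0})\|_{L_2}=o(\|h\|)$ as $h\to0$. $\Psi_2(\theta_0)$ is the set of maps $\psi$ with $\psi\in L_2^p(P_{\theta_0})$, $\mathbb{E}_{\theta_0}[\psi]=0$ and $\mathbb{E}_{\theta_0}[\psi\Lambda_{\theta_0}^T]=I_p$. The influence curve of a statistical functional $T$ at $x$ for $P$ is $\lim_{t\to0}\,(T((1-t)P+t\delta_x)-T(P))/t$, where a functional on $\mathcal{C}^p(\Theta)$ is viewed as a statistical functional through the map $P\mapsto \int\varphi\,dP+J_\lambda'$. A map $T$ between normed real vector spaces is compactly (Hadamard) differentiable at $x$ with derivative the continuous linear map $d_HT(x)$ if $T(x+th)=T(x)+t\,d_HT(x)h+\rho(th)$ with $\rho(0)=0$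 and $\|\rho(th)\|/t\to0$ as $t\to0$ uniformly in $h\in K$ for every compact $K$. M-functional: $T:V\to\Theta$ is the functional on a neighborhood $V\subset\mathcal{C}^p(\Theta)$ of $\eta^\lambda$ with $f(T(f))=0$ for all $f\in V$ and $T(\eta^\lambda)=\theta_0$, which is compactly differentiable at $\eta^\lambda$ with derivative $-(d\eta^\lambda(\theta_0))^{-1}\circ\Pi_{\theta_0}$, where $\Pi_{\theta_0}$ is evaluation at $\theta_0$. Asymptotic linearity of $(S_n)_n$ at $P_{\theta_0}$: there is an influence curve $\psi_{\theta_0}\in\Psi_2(\theta_0)$ with $S_n=\theta_0+\frac1n\sum_{i=1}^n\psi_{\theta_0}(X_i,Y_i)+o_{P_{\theta_0}^n}(n^{-1/2})$.
   Formalization: Interchangeability of integration and differentiation in θ is taken, for the loss and for φ^λ, in the dominated form: the θ-derivatives have an F-integrable majorant locally uniformly in θ. With the bare interchange identity the claim fails. *)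

theory Defs
  imports "HOL-Probability.Probability"
begin

text \<open>The regression model is the map \<open>x \<mapsto> x \<bullet> \<theta>\<close>; a data point is a pair \<open>z = (x, y)\<close>.\<close>

definition lin_reg :: "real^'p \<Rightarrow> real^'p \<Rightarrow> real" where
  "lin_reg \<theta> = (\<lambda>x. x \<bullet> \<theta>)"

definition reg_error :: "real^'p \<Rightarrow> (real^'p) \<times> real \<Rightarrow> real" where
  "reg_error \<theta> z = snd z - lin_reg \<theta> (fst z)"

definition linear_regression_model ::
  "(real^'p) set \<Rightarrow> real set \<Rightarrow> (real^'p) set \<Rightarrow> (real^'p \<Rightarrow> ((real^'p) \<times> real) measure) \<Rightarrow> bool" where
  "linear_regression_model \<X> \<Y> \<Theta> P \<longleftrightarrow>
     (\<forall>\<theta>\<in>\<Theta>. prob_space (P \<theta>)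
        \<and> sets (P \<theta>) = sets (restrict_space borel (\<X> \<times> \<Y>))
        \<and> integrable (P \<theta>) (reg_error \<theta>) \<and> (LINT z|P \<theta>. reg_error \<theta> z) = 0
        \<and> integrable (P \<theta>) (\<lambda>z. (reg_error \<theta> z)\<^sup>2) \<and> (LINT z|P \<theta>. (reg_error \<theta> z)\<^sup>2) > 0)"

definition L2_space :: "'z measure \<Rightarrow> ('z \<Rightarrow> real^'p) set" where
  "L2_space F = {f \<in> borel_measurable F. integrable F (\<lambda>z. (norm (f z))\<^sup>2)}"

text \<open>The library has scaling and suprema of measures, but no sum.\<close>

definition add_measure :: "'z measure \<Rightarrow> 'z measure \<Rightarrow> 'z measure" where
  "add_measure P Q = measure_of (space P) (sets P) (\<lambda>A. emeasure P A + emeasure Q A)"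

lemma
  shows space_add_measure [simp]: "space (add_measure P Q) = space P"
    and sets_add_measure [simp, measurable_cong]: "sets (add_measure P Q) = sets P"
  by (simp_all add: add_measure_def)

lemma emeasure_add_measure:
  assumes [measurable_cong]: "sets Q = sets P" and A: "A \<in> sets P"
  shows "emeasure (add_measure P Q) A = emeasure P A + emeasure Q A"
  unfolding add_measure_def
proof (rule emeasure_measure_of_sigma)
  show "countably_additive (sets P) (\<lambda>A. emeasure P A + emeasure Q A)"
    by (auto simp: countably_additive_def suminf_add [symmetric] suminf_emeasure assms)
qed (auto simp: positive_def A sets.sigma_algebra_axioms)

text \<open>The density of \<open>P\<close> with respect to a measure \<open>\<mu>\<close>, under a square root. For
  \<open>L\<^sub>2\<close>-differentiability the dominating measure is taken to be \<open>P \<theta>' + P \<theta>\<close>; the norm of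
  \<open>\<surd>dP \<theta>' - \<surd>dP \<theta> (1 + \<dots>)\<close> does not depend on that choice.\<close>

definition root_density :: "'z measure \<Rightarrow> 'z measure \<Rightarrow> 'z \<Rightarrow> real" where
  "root_density \<mu> P z = sqrt (enn2real (RN_deriv \<mu> P z))"

definition L2_differentiable_at ::
  "(real^'p \<Rightarrow> 'z measure) \<Rightarrow> (real^'p) set \<Rightarrow> real^'p \<Rightarrow> ('z \<Rightarrow> real^'p) \<Rightarrow> bool" where
  "L2_differentiable_at P \<Theta> \<theta> \<Lambda> \<longleftrightarrow>
     \<Lambda> \<in> L2_space (P \<theta>) \<and>
     (\<lambda>h. let \<mu> = add_measure (P (\<theta> + h)) (P \<theta>) in
          sqrt (LINT z|\<mu>. (root_density \<mu> (P (\<theta> + h)) z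
                          - root_density \<mu> (P \<theta>) z * (1 + (h \<bullet> \<Lambda> z) / 2))\<^sup>2))
       \<in> o[at 0 within {h. \<theta> + h \<in> \<Theta>}](\<lambda>h. norm h)"

definition Psi2 :: "'z measure \<Rightarrow> ('z \<Rightarrow> real^'p) \<Rightarrow> ('z \<Rightarrow> real^'p) set" where
  "Psi2 P \<Lambda> = {\<psi> \<in> L2_space P. (LINT z|P. \<psi> z) = 0 \<and>
                 (\<forall>i j. (LINT z|P. \<psi> z $ i * \<Lambda> z $ j) = (mat 1 :: real^'p^'p) $ i $ j)}"

text \<open>A statistical functional is a map \<open>S\<close> on a set \<open>D\<close> of measures. The limit is one-sided because
  \<open>(1 - t) P + t \<delta>\<^sub>x\<close> is a measure only for \<open>0 \<le> t \<le> 1\<close>.\<close>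

definition contaminate :: "real \<Rightarrow> 'z measure \<Rightarrow> 'z \<Rightarrow> 'z measure" where
  "contaminate t P x =
     add_measure (scale_measure (ennreal (1 - t)) P) (scale_measure (ennreal t) (return P x))"

definition influence_curve ::
  "'z measure set \<Rightarrow> ('z measure \<Rightarrow> real^'p) \<Rightarrow> 'z measure \<Rightarrow> ('z \<Rightarrow> real^'p) \<Rightarrow> bool" where
  "influence_curve D S P \<psi> \<longleftrightarrow> P \<in> D \<and>
     (\<forall>x\<in>space P. (\<forall>\<^sub>F t in at_right 0. contaminate t P x \<in> D) \<and>
        ((\<lambda>t. (S (contaminate t P x) - S P) /\<^sub>R t) \<longlongrightarrow> \<psi> x) (at_right 0))"

text \<open>The space of continuous functions on the compact set \<open>\<Theta>\<close> with the supremum distance. As in the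
  library, its elements are \<open>undefined\<close> outside \<open>\<Theta>\<close>, so that functions are put into it by
  \<open>restrict\<close>, also after a pointwise vector space operation.\<close>

definition C_space :: "(real^'p) set \<Rightarrow> (real^'p \<Rightarrow> real^'p) metric" where
  "C_space \<Theta> = cfunspace (top_of_set \<Theta>) euclidean_metric"

definition C_comb ::
  "(real^'p) set \<Rightarrow> (real^'p \<Rightarrow> real^'p) \<Rightarrow> real \<Rightarrow> (real^'p \<Rightarrow> real^'p) \<Rightarrow> real^'p \<Rightarrow> real^'p" where
  "C_comb \<Theta> f t h = restrict (\<lambda>\<theta>. f \<theta> + t *\<^sub>R h \<theta>) \<Theta>"

definition C_continuous_linear ::
  "(real^'p) set \<Rightarrow> ((real^'p \<Rightarrow> real^'p) \<Rightarrow> real^'p) \<Rightarrow> bool" where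
  "C_continuous_linear \<Theta> D \<longleftrightarrow>
     continuous_map (mtopology_of (C_space \<Theta>)) euclidean D \<and>
     (\<forall>f\<in>mspace (C_space \<Theta>). \<forall>g\<in>mspace (C_space \<Theta>). \<forall>c. D (C_comb \<Theta> f c g) = D f + c *\<^sub>R D g)"

text \<open>The values of \<open>T\<close> away from a neighbourhood of \<open>f\<close> do not matter here, since compact sets of
  directions are bounded.\<close>

definition hadamard_derivative_at ::
  "(real^'p) set \<Rightarrow> ((real^'p \<Rightarrow> real^'p) \<Rightarrow> real^'p) \<Rightarrow> (real^'p \<Rightarrow> real^'p)
     \<Rightarrow> ((real^'p \<Rightarrow> real^'p) \<Rightarrow> real^'p) \<Rightarrow> bool" where
  "hadamard_derivative_at \<Theta> T f D \<longleftrightarrow>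
     C_continuous_linear \<Theta> D \<and>
     (\<forall>K. compactin (mtopology_of (C_space \<Theta>)) K \<longrightarrow>
        uniform_limit K (\<lambda>t h. norm (T (C_comb \<Theta> f t h) - T f - t *\<^sub>R D h) / t) (\<lambda>_. 0) (at 0))"

definition locally_homeomorphic_at ::
  "(real^'p) set \<Rightarrow> (real^'p \<Rightarrow> real^'p) \<Rightarrow> real^'p \<Rightarrow> bool" where
  "locally_homeomorphic_at \<Theta> f \<theta> \<longleftrightarrow>
     (\<exists>U W g. open U \<and> \<theta> \<in> U \<and> U \<subseteq> \<Theta> \<and> open W \<and> homeomorphism U W f g)"

text \<open>\<open>V\<close> is a neighbourhood of \<open>\<eta>\<close>, and \<open>d\<eta>\<close> is the derivative of \<open>\<eta>\<close> at its zero \<open>\<theta>\<^sub>0\<close>.\<close>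

definition M_functional ::
  "(real^'p) set \<Rightarrow> (real^'p \<Rightarrow> real^'p) \<Rightarrow> real^'p \<Rightarrow> (real^'p \<Rightarrow> real^'p)
     \<Rightarrow> (real^'p \<Rightarrow> real^'p) set \<Rightarrow> ((real^'p \<Rightarrow> real^'p) \<Rightarrow> real^'p) \<Rightarrow> bool" where
  "M_functional \<Theta> \<eta> \<theta>\<^sub>0 d\<eta> V T \<longleftrightarrow>
     V \<subseteq> mspace (C_space \<Theta>) \<and> (\<exists>U. openin (mtopology_of (C_space \<Theta>)) U \<and> \<eta> \<in> U \<and> U \<subseteq> V) \<and>
     T \<in> V \<rightarrow> \<Theta> \<and> (\<forall>f\<in>V. f (T f) = 0) \<and> T \<eta> = \<theta>\<^sub>0 \<and>
     hadamard_derivative_at \<Theta> T \<eta> (\<lambda>h. - inv d\<eta> (h \<theta>\<^sub>0))"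

text \<open>Here \<open>\<phi> z \<theta>\<close> is the gradient of the loss and \<open>J' \<theta>\<close> the gradient of the penalty; at boundary
  points of \<open>\<Theta>\<close> derivatives are derivatives within \<open>\<Theta>\<close>.\<close>

definition eta_reg ::
  "(real^'p) set \<Rightarrow> ('z \<Rightarrow> real^'p \<Rightarrow> real^'p) \<Rightarrow> (real^'p \<Rightarrow> real^'p) \<Rightarrow> 'z measure \<Rightarrow> real^'p \<Rightarrow> real^'p" where
  "eta_reg \<Theta> \<phi> J' Q = restrict (\<lambda>\<theta>. (LINT z|Q. \<phi> z \<theta>) + J' \<theta>) \<Theta>"

definition Z_reg ::
  "(real^'p) set \<Rightarrow> ('z \<Rightarrow> real^'p \<Rightarrow> real^'p) \<Rightarrow> (real^'p \<Rightarrow> real^'p) \<Rightarrow> (nat \<Rightarrow> 'w \<Rightarrow> 'z)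
     \<Rightarrow> nat \<Rightarrow> 'w \<Rightarrow> real^'p \<Rightarrow> real^'p" where
  "Z_reg \<Theta> \<phi> J' obs n \<omega> = restrict (\<lambda>\<theta>. (\<Sum>i<n. \<phi> (obs i \<omega>) \<theta>) /\<^sub>R real n + J' \<theta>) \<Theta>"

definition stat_domain ::
  "(real^'p) set \<Rightarrow> ('z \<Rightarrow> real^'p \<Rightarrow> real^'p) \<Rightarrow> (real^'p \<Rightarrow> real^'p) \<Rightarrow> (real^'p \<Rightarrow> real^'p) set
     \<Rightarrow> 'z measure set" where
  "stat_domain \<Theta> \<phi> J' V = {Q. (\<forall>\<theta>\<in>\<Theta>. integrable Q (\<lambda>z. \<phi> z \<theta>)) \<and> eta_reg \<Theta> \<phi> J' Q \<in> V}"

text \<open>Interchangeability of integration and differentiation in \<open>\<theta>\<close> for \<open>f\<close> with derivative \<open>f'\<close>: the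
  derivative of \<open>\<integral> f z \<theta> dF\<close> is \<open>\<integral> f' z \<theta> dF\<close>, in the dominated form of Leibniz's rule, i.e. with a
  locally uniform integrable majorant of the derivative. The bare identity of the two derivatives, which
  concerns one \<open>\<theta>\<close> at a time, would not control sample means uniformly near \<open>\<theta>\<close>.\<close>

definition diff_under_integral ::
  "'z measure \<Rightarrow> (real^'p) set \<Rightarrow> ('z \<Rightarrow> real^'p \<Rightarrow> 'b)
     \<Rightarrow> ('z \<Rightarrow> real^'p \<Rightarrow> real^'p \<Rightarrow> 'b::{banach, second_countable_topology}) \<Rightarrow> bool" where
  "diff_under_integral F \<Theta> f f' \<longleftrightarrow>
     (\<forall>\<theta>\<in>\<Theta>. integrable F (\<lambda>z. f z \<theta>) \<and> (\<forall>h. integrable F (\<lambda>z. f' z \<theta> h)) \<and>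
        ((\<lambda>\<theta>'. LINT z|F. f z \<theta>') has_derivative (\<lambda>h. LINT z|F. f' z \<theta> h)) (at \<theta> within \<Theta>) \<and>
        (\<exists>U G. open U \<and> \<theta> \<in> U \<and> integrable F G \<and>
           (AE z in F. \<forall>\<theta>'\<in>U \<inter> \<Theta>. \<forall>h. norm (f' z \<theta>' h) \<le> G z * norm h)))"

definition twice_differentiable_on ::
  "('a::real_normed_vector \<Rightarrow> 'b::real_normed_vector) \<Rightarrow> 'a set \<Rightarrow> bool" where
  "twice_differentiable_on f S \<longleftrightarrow>
     (\<exists>f' :: 'a \<Rightarrow> 'a \<Rightarrow>\<^sub>L 'b. (\<forall>x\<in>S. (f has_derivative blinfun_apply (f' x)) (at x within S))
        \<and> f' differentiable_on S)"

text \<open>Stochastic orders. Outer measure is used because \<open>T\<close>, and hence an estimator \<open>T (Z\<^sub>n)\<close>, is not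
  assumed to be measurable; on measurable events it is the probability.\<close>

definition bounded_in_prob :: "'w measure \<Rightarrow> (nat \<Rightarrow> 'w \<Rightarrow> real^'p) \<Rightarrow> bool" where
  "bounded_in_prob M R \<longleftrightarrow>
     (\<forall>\<epsilon>>0. \<exists>C N. \<forall>n\<ge>N. outer_measure_of M {\<omega>\<in>space M. norm (R n \<omega>) > C} \<le> ennreal \<epsilon>)"

definition null_in_prob :: "'w measure \<Rightarrow> (nat \<Rightarrow> 'w \<Rightarrow> real^'p) \<Rightarrow> bool" where
  "null_in_prob M R \<longleftrightarrow>
     (\<forall>\<epsilon>>0. (\<lambda>n. outer_measure_of M {\<omega>\<in>space M. norm (R n \<omega>) > \<epsilon>}) \<longlonglongrightarrow> 0)"

definition root_n_consistent :: "'w measure \<Rightarrow> (nat \<Rightarrow> 'w \<Rightarrow> real^'p) \<Rightarrow> real^'p \<Rightarrow> bool" where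
  "root_n_consistent M S \<theta>\<^sub>0 \<longleftrightarrow> bounded_in_prob M (\<lambda>n \<omega>. sqrt (real n) *\<^sub>R (S n \<omega> - \<theta>\<^sub>0))"

definition asymptotically_linear ::
  "'w measure \<Rightarrow> (nat \<Rightarrow> 'w \<Rightarrow> 'z) \<Rightarrow> 'z measure \<Rightarrow> ('z \<Rightarrow> real^'p) \<Rightarrow> (nat \<Rightarrow> 'w \<Rightarrow> real^'p)
     \<Rightarrow> real^'p \<Rightarrow> bool" where
  "asymptotically_linear M obs P \<Lambda> S \<theta>\<^sub>0 \<longleftrightarrow>
     (\<exists>\<psi>\<in>Psi2 P \<Lambda>. null_in_prob M
        (\<lambda>n \<omega>. sqrt (real n) *\<^sub>R (S n \<omega> - \<theta>\<^sub>0 - (\<Sum>i<n. \<psi> (obs i \<omega>)) /\<^sub>R real n)))"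

end

theory Submission
  imports Defs
begin

text \<open>
  Write \<open>F = P \<theta>\<^sub>0\<close>. On the neighbourhood \<open>V\<close> of \<open>\<eta>\<close> the functional \<open>T\<close> selects zeros, so with probability tending to
  one \<open>S\<^sub>n\<close> is a zero of \<open>Z\<^sub>n\<close>: it suffices that \<open>Z\<^sub>n\<close> converges to \<open>\<eta>\<close> uniformly on \<open>\<Theta>\<close> in probability. This is a
  uniform law of large numbers (\<open>uniform_law\<close>), which holds because \<open>\<phi>\<^sub>J\<close> is continuous in \<open>\<theta>\<close> and locally
  dominated.

  Linearizing \<open>Z\<^sub>n\<close> at \<open>\<theta>\<^sub>0\<close> gives
  \<open>0 = Z\<^sub>n(S\<^sub>n) = Z\<^sub>n(\<theta>\<^sub>0) + d\<eta> (S\<^sub>n - \<theta>\<^sub>0) + o\<^sub>P(norm (S\<^sub>n - \<theta>\<^sub>0))\<close>,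
  where the error is uniform over a neighbourhood of \<open>\<theta>\<^sub>0\<close> (\<open>uniform_linearization\<close>); this uniformity is needed because
  \<open>S\<^sub>n\<close> is random. Applying the inverse of \<open>d\<eta>\<close> and using that \<open>\<surd>n (S\<^sub>n - \<theta>\<^sub>0)\<close> is stochastically bounded
  (\<open>null_in_prob_if_small_relative\<close>) one obtains
  \<open>S\<^sub>n = \<theta>\<^sub>0 - (d\<eta>)\<^sup>-\<^sup>1 Z\<^sub>n(\<theta>\<^sub>0) + o\<^sub>P(1 / \<surd>n)\<close>,
  and \<open>- (d\<eta>)\<^sup>-\<^sup>1 Z\<^sub>n(\<theta>\<^sub>0)\<close> is the sample mean of \<open>\<psi> z = - (d\<eta>)\<^sup>-\<^sup>1 (\<phi>\<^sub>J z \<theta>\<^sub>0)\<close>.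

  Integrable majorants do not provide a central limit theorem for \<open>\<surd>n (Z\<^sub>n - \<eta>)\<close> in the space of continuous functions,
  so the functional delta method is replaced by this linearization at the single point \<open>\<theta>\<^sub>0\<close>. Differentiability of \<open>T\<close>
  serves to identify \<open>\<psi>\<close>: along contaminations of \<open>F\<close> it shows that \<open>\<psi>\<close> is the influence curve of \<open>T\<close>
  (\<open>influence_curve_M_functional\<close>), and hence a member of \<open>\<Psi>\<^sub>2(\<theta>\<^sub>0)\<close>.
\<close>

section \<open>Convergence in outer probability\<close>

lemma outer_measure_of_Un_le:
  assumes "A \<subseteq> space M" "B \<subseteq> space M"
  shows "outer_measure_of M (A \<union> B) \<le> outer_measure_of M A + outer_measure_of M B"
proof -
  obtain E where E: "E \<in> sets M" "A \<subseteq> E" "outer_measure_of M A = emeasure M E"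
    using outer_measure_of_attain[OF assms(1)] by blast
  obtain E' where E': "E' \<in> sets M" "B \<subseteq> E'" "outer_measure_of M B = emeasure M E'"
    using outer_measure_of_attain[OF assms(2)] by blast
  have "outer_measure_of M (A \<union> B) \<le> outer_measure_of M (E \<union> E')"
    using E E' by (intro outer_measure_of_mono) auto
  also have "\<dots> = emeasure M (E \<union> E')" using E E' by simp
  also have "\<dots> \<le> emeasure M E + emeasure M E'"
    using E E' by (intro emeasure_subadditive)
  finally show ?thesis using E E' by simp
qed

text \<open>Convergence in probability becomes a limit along this filter, so that
  \<open>eventually_elim\<close> and the limit calculus replace the bookkeeping with unions of exceptional events; as
  the probability is an outer one, the events may be nonmeasurable.\<close>

definition high_prob :: "'w measure \<Rightarrow> (nat \<times> 'w) filter" where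
  "high_prob M = Abs_filter (\<lambda>Q. (\<lambda>n. outer_measure_of M {\<omega>\<in>space M. \<not> Q (n, \<omega>)}) \<longlonglongrightarrow> 0)"

text \<open>Subadditivity of outer measure is what makes the family of such properties closed under conjunction, hence
  a filter.\<close>

lemma eventually_high_prob:
  "eventually Q (high_prob M) \<longleftrightarrow> (\<lambda>n. outer_measure_of M {\<omega>\<in>space M. \<not> Q (n, \<omega>)}) \<longlonglongrightarrow> 0"
  unfolding high_prob_def
proof (rule eventually_Abs_filter, rule is_filter.intro)
  show "(\<lambda>n. outer_measure_of M {\<omega> \<in> space M. \<not> True}) \<longlonglongrightarrow> 0" by simp
next
  fix Q R :: "nat \<times> 'a \<Rightarrow> bool"
  assume Q: "(\<lambda>n. outer_measure_of M {\<omega> \<in> space M. \<not> Q (n, \<omega>)}) \<longlonglongrightarrow> 0"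
    and R: "(\<lambda>n. outer_measure_of M {\<omega> \<in> space M. \<not> R (n, \<omega>)}) \<longlonglongrightarrow> 0"
  have *: "{\<omega> \<in> space M. \<not> (Q (n, \<omega>) \<and> R (n, \<omega>))} =
      {\<omega> \<in> space M. \<not> Q (n, \<omega>)} \<union> {\<omega> \<in> space M. \<not> R (n, \<omega>)}" for n by auto
  show "(\<lambda>n. outer_measure_of M {\<omega> \<in> space M. \<not> (Q (n, \<omega>) \<and> R (n, \<omega>))}) \<longlonglongrightarrow> 0"
  proof (rule tendsto_sandwich[OF _ _ tendsto_const])
    show "(\<lambda>n. outer_measure_of M {\<omega> \<in> space M. \<not> Q (n, \<omega>)} +
        outer_measure_of M {\<omega> \<in> space M. \<not> R (n, \<omega>)}) \<longlonglongrightarrow> 0"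
      using tendsto_add[OF Q R] by simp
  qed (unfold *, auto intro!: always_eventually outer_measure_of_Un_le)
next
  fix Q R :: "nat \<times> 'a \<Rightarrow> bool"
  assume QR: "\<forall>x. Q x \<longrightarrow> R x" and Q: "(\<lambda>n. outer_measure_of M {\<omega> \<in> space M. \<not> Q (n, \<omega>)}) \<longlonglongrightarrow> 0"
  show "(\<lambda>n. outer_measure_of M {\<omega> \<in> space M. \<not> R (n, \<omega>)}) \<longlonglongrightarrow> 0"
    by (rule tendsto_sandwich[OF _ _ tendsto_const Q])
      (use QR in \<open>auto intro!: always_eventually outer_measure_of_mono\<close>)
qed

lemma null_in_prob_iff_tendsto:
  "null_in_prob M R \<longleftrightarrow> ((\<lambda>(n, \<omega>). R n \<omega>) \<longlongrightarrow> 0) (high_prob M)"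
proof
  assume N: "null_in_prob M R"
  show "((\<lambda>(n, \<omega>). R n \<omega>) \<longlongrightarrow> 0) (high_prob M)"
  proof (rule tendstoI)
    fix e :: real assume "0 < e"
    then have "(\<lambda>n. outer_measure_of M {\<omega>\<in>space M. norm (R n \<omega>) > e / 2}) \<longlonglongrightarrow> 0"
      using N half_gt_zero unfolding null_in_prob_def by blast
    then have "eventually (\<lambda>(n, \<omega>). norm (R n \<omega>) \<le> e / 2) (high_prob M)"
      by (simp add: eventually_high_prob not_le)
    then show "\<forall>\<^sub>F x in high_prob M. dist (case x of (n, \<omega>) \<Rightarrow> R n \<omega>) 0 < e"
      by eventually_elim (use \<open>0 < e\<close> in auto)
  qed
next
  assume T: "((\<lambda>(n, \<omega>). R n \<omega>) \<longlongrightarrow> 0) (high_prob M)"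
  show "null_in_prob M R"
    unfolding null_in_prob_def
  proof (intro allI impI)
    fix e :: real assume "0 < e"
    from tendstoD[OF T this] have "eventually (\<lambda>(n, \<omega>). norm (R n \<omega>) \<le> e) (high_prob M)"
      by eventually_elim auto
    then show "(\<lambda>n. outer_measure_of M {\<omega>\<in>space M. norm (R n \<omega>) > e}) \<longlonglongrightarrow> 0"
      by (simp add: eventually_high_prob not_le)
  qed
qed

lemma eventually_high_prob_AE:
  assumes "\<And>n. n \<ge> n\<^sub>0 \<Longrightarrow> AE \<omega> in M. Q (n, \<omega>)"
  shows "eventually Q (high_prob M)"
  unfolding eventually_high_prob
proof (rule tendsto_eventually, rule eventually_sequentiallyI)
  fix n assume "n \<ge> n\<^sub>0"
  from assms[OF this] obtain N where N: "{\<omega>\<in>space M. \<not> Q (n, \<omega>)} \<subseteq> N" "emeasure M N = 0" "N \<in> sets M"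
    by (rule AE_E)
  then show "outer_measure_of M {\<omega>\<in>space M. \<not> Q (n, \<omega>)} = 0"
    using outer_measure_of_mono[OF N(1), of M] by simp
qed

text \<open>Markov's inequality.\<close>

lemma tendsto_high_prob_L1:
  fixes Y :: "nat \<Rightarrow> 'w \<Rightarrow> real"
  assumes int: "\<And>n. integrable M (Y n)" and lim: "(\<lambda>n. LINT \<omega>|M. \<bar>Y n \<omega>\<bar>) \<longlonglongrightarrow> 0"
  shows "((\<lambda>(n, \<omega>). Y n \<omega>) \<longlongrightarrow> 0) (high_prob M)"
proof (rule tendstoI)
  fix e :: real assume e: "0 < e"
  have [measurable]: "Y n \<in> borel_measurable M" for n using int by auto
  have "(\<lambda>n. outer_measure_of M {\<omega>\<in>space M. \<not> \<bar>Y n \<omega>\<bar> < e}) \<longlonglongrightarrow> 0"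
  proof (rule tendsto_sandwich[OF _ _ tendsto_const])
    have "outer_measure_of M {\<omega>\<in>space M. \<not> \<bar>Y n \<omega>\<bar> < e} \<le> ennreal ((LINT \<omega>|M. \<bar>Y n \<omega>\<bar>) / e)" for n
    proof -
      have "emeasure M {\<omega>\<in>space M. \<bar>Y n \<omega>\<bar> \<ge> e} \<le> ennreal ((LINT \<omega>|M. \<bar>Y n \<omega>\<bar>) / e)"
        using integral_Markov_inequality[of M "\<lambda>\<omega>. \<bar>Y n \<omega>\<bar>" e] int e by simp
      then show ?thesis by (simp add: not_less)
    qed
    then show "\<forall>\<^sub>F n in sequentially. outer_measure_of M {\<omega>\<in>space M. \<not> \<bar>Y n \<omega>\<bar> < e}
        \<le> ennreal ((LINT \<omega>|M. \<bar>Y n \<omega>\<bar>) / e)" by simp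
    show "(\<lambda>n. ennreal ((LINT \<omega>|M. \<bar>Y n \<omega>\<bar>) / e)) \<longlonglongrightarrow> 0"
      using tendsto_ennrealI[OF tendsto_divide[OF lim tendsto_const, of e]] e by simp
  qed auto
  then show "\<forall>\<^sub>F x in high_prob M. dist (case x of (n, \<omega>) \<Rightarrow> Y n \<omega>) 0 < e"
    by (simp add: eventually_high_prob)
qed

text \<open>The rule \<open>o\<^sub>P(1) \<cdot> O\<^sub>P(1) = o\<^sub>P(1)\<close>. It is not an instance of a filter rule, because stochastic boundedness
  is weaker than being eventually bounded: the bound may depend on the admitted probability of failure.\<close>

lemma null_in_prob_if_small_relative:
  assumes B: "bounded_in_prob M B"
    and small: "\<And>e. e > 0 \<Longrightarrow> eventually (\<lambda>(n, \<omega>). norm (R n \<omega>) \<le> e * norm (B n \<omega>)) (high_prob M)"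
  shows "null_in_prob M R"
  unfolding null_in_prob_def
proof (intro allI impI)
  fix r :: real assume r: "r > 0"
  show "(\<lambda>n. outer_measure_of M {\<omega>\<in>space M. norm (R n \<omega>) > r}) \<longlonglongrightarrow> 0"
  proof (rule tendsto_zero_ennreal)
    fix k :: real assume k: "k > 0"
    obtain C N where C: "\<And>n. n \<ge> N \<Longrightarrow> outer_measure_of M {\<omega>\<in>space M. norm (B n \<omega>) > C} \<le> ennreal (k / 2)"
      using B k unfolding bounded_in_prob_def by (meson half_gt_zero)
    \<comment> \<open>On the event \<open>norm B \<le> C\<close> this choice turns the relative bound into the absolute bound
      \<open>r\<close>.\<close>
    define e where "e = r / (\<bar>C\<bar> + 1)"
    have e: "e > 0" using r by (simp add: e_def)
    let ?A = "\<lambda>n. {\<omega>\<in>space M. \<not> norm (R n \<omega>) \<le> e * norm (B n \<omega>)}"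
    let ?B = "\<lambda>n. {\<omega>\<in>space M. norm (B n \<omega>) > C}"
    have "(\<lambda>n. outer_measure_of M (?A n)) \<longlonglongrightarrow> 0"
      using small[OF e] by (simp add: eventually_high_prob)
    then have "\<forall>\<^sub>F n in sequentially. outer_measure_of M (?A n) < ennreal (k / 2)"
      by (rule order_tendstoD) (use k in auto)
    then show "\<forall>\<^sub>F n in sequentially. outer_measure_of M {\<omega>\<in>space M. norm (R n \<omega>) > r} < ennreal k"
      using eventually_ge_at_top[of N]
    proof eventually_elim
      fix n assume n: "outer_measure_of M (?A n) < ennreal (k / 2)" "n \<ge> N"
      have "{\<omega>\<in>space M. norm (R n \<omega>) > r} \<subseteq> ?A n \<union> ?B n"
      proof safe
        fix \<omega> assume w: "norm (R n \<omega>) > r" "\<not> norm (B n \<omega>) > C" "norm (R n \<omega>) \<le> e * norm (B n \<omega>)"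
        have "e * norm (B n \<omega>) \<le> e * (\<bar>C\<bar> + 1)" using e w by (intro mult_left_mono) auto
        also have "\<dots> = r" by (simp add: e_def)
        finally show False using w by simp
      qed
      then have "outer_measure_of M {\<omega>\<in>space M. norm (R n \<omega>) > r} \<le> outer_measure_of M (?A n \<union> ?B n)"
        by (rule outer_measure_of_mono)
      also have "\<dots> \<le> outer_measure_of M (?A n) + outer_measure_of M (?B n)"
        by (rule outer_measure_of_Un_le) auto
      also have "\<dots> \<le> outer_measure_of M (?A n) + ennreal (k / 2)"
        using C[OF n(2)] by (intro add_left_mono)
      also have "\<dots> < ennreal (k / 2) + ennreal (k / 2)"
        using n(1) by (simp add: add.commute ennreal_add_left_cancel_less)
      also have "\<dots> = ennreal k" using k by (simp add: ennreal_plus[symmetric] del: ennreal_plus)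
      finally show "outer_measure_of M {\<omega>\<in>space M. norm (R n \<omega>) > r} < ennreal k" .
    qed
  qed
qed

text \<open>The deviation is itself \<open>1 / \<surd>n\<close> times a stochastically bounded sequence.\<close>

lemma root_n_consistent_tendsto:
  assumes "root_n_consistent M S \<theta>\<^sub>0"
  shows "((\<lambda>(n, \<omega>). S n \<omega>) \<longlongrightarrow> \<theta>\<^sub>0) (high_prob M)"
proof -
  let ?B = "\<lambda>n \<omega>. sqrt (real n) *\<^sub>R (S n \<omega> - \<theta>\<^sub>0)"
  have "null_in_prob M (\<lambda>n \<omega>. S n \<omega> - \<theta>\<^sub>0)"
  proof (rule null_in_prob_if_small_relative)
    show "bounded_in_prob M ?B" using assms by (simp add: root_n_consistent_def)
    fix e :: real assume e: "e > 0"
    obtain k :: nat where k: "1 / e\<^sup>2 < real k" using reals_Archimedean2 by blast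
    show "eventually (\<lambda>(n, \<omega>). norm (S n \<omega> - \<theta>\<^sub>0) \<le> e * norm (?B n \<omega>)) (high_prob M)"
    proof (rule eventually_high_prob_AE, clarsimp)
      fix n assume n: "k \<le> n"
      then have "1 / e\<^sup>2 \<le> real n" using k by linarith
      then have "sqrt (1 / e\<^sup>2) \<le> sqrt n" by (rule real_sqrt_le_mono)
      then have "1 \<le> e * sqrt n" using e by (simp add: real_sqrt_divide field_simps)
      then have "1 * norm (S n \<omega> - \<theta>\<^sub>0) \<le> (e * sqrt n) * norm (S n \<omega> - \<theta>\<^sub>0)" for \<omega>
        by (intro mult_right_mono) auto
      then show "AE \<omega> in M. norm (S n \<omega> - \<theta>\<^sub>0) \<le> e * (sqrt n * norm (S n \<omega> - \<theta>\<^sub>0))"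
        by (simp add: mult.assoc)
    qed
  qed
  then have "((\<lambda>x. (case x of (n, \<omega>) \<Rightarrow> S n \<omega> - \<theta>\<^sub>0) + \<theta>\<^sub>0) \<longlongrightarrow> 0 + \<theta>\<^sub>0) (high_prob M)"
    unfolding null_in_prob_iff_tendsto by (intro tendsto_add tendsto_const)
  then show ?thesis by (simp add: case_prod_unfold)
qed

section \<open>Sample means and the weak law of large numbers\<close>

locale iid_sample = prob_space M for M :: "'w measure" +
  fixes F :: "'z measure" and obs :: "nat \<Rightarrow> 'w \<Rightarrow> 'z"
  assumes indep: "indep_vars (\<lambda>_. F) obs UNIV"
    and distr_obs: "\<And>i. distr M F (obs i) = F"
begin

lemma measurable_obs [measurable]: "obs i \<in> measurable M F"
  using indep by (simp add: indep_vars_def)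

lemma obs_in_space: "\<omega> \<in> space M \<Longrightarrow> obs i \<omega> \<in> space F"
  using measurable_obs by (rule measurable_space)

lemma prob_space_F: "prob_space F"
  using prob_space_distr[OF measurable_obs, of 0] by (simp add: distr_obs)

text \<open>A null set of \<open>F\<close> is avoided by all observations at once, since there are countably many.\<close>

lemma AE_obs:
  assumes "AE z in F. Q z" shows "AE \<omega> in M. \<forall>i. Q (obs i \<omega>)"
  unfolding AE_all_countable
proof
  fix i
  have "AE z in distr M F (obs i). Q z" using assms by (simp only: distr_obs)
  from AE_distrD[OF measurable_obs this] show "AE \<omega> in M. Q (obs i \<omega>)" .
qed

definition sample_mean :: "nat \<Rightarrow> ('z \<Rightarrow> 'b::real_vector) \<Rightarrow> 'w \<Rightarrow> 'b" where
  "sample_mean n f \<omega> = (\<Sum>i<n. f (obs i \<omega>)) /\<^sub>R real n"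

lemma integrable_obs:
  fixes f :: "'z \<Rightarrow> 'b::{banach, second_countable_topology}"
  assumes "integrable F f"
  shows "integrable M (\<lambda>\<omega>. f (obs i \<omega>))" "(LINT \<omega>|M. f (obs i \<omega>)) = (LINT z|F. f z)"
proof -
  have "integrable (distr M F (obs i)) f" using assms by (simp add: distr_obs)
  then show "integrable M (\<lambda>\<omega>. f (obs i \<omega>))" by (rule integrable_distr[OF measurable_obs])
  have "(LINT z|F. f z) = (LINT z|distr M F (obs i). f z)" by (simp add: distr_obs)
  also have "\<dots> = (LINT \<omega>|M. f (obs i \<omega>))"
    using assms by (intro integral_distr) auto
  finally show "(LINT \<omega>|M. f (obs i \<omega>)) = (LINT z|F. f z)" by simp
qed

lemma sample_mean_diff:
  "sample_mean n (\<lambda>z. f z - g z) \<omega> = sample_mean n f \<omega> - sample_mean n g \<omega>"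
  by (simp add: sample_mean_def sum_subtractf scaleR_diff_right)

lemma sample_mean_const: "n \<noteq> 0 \<Longrightarrow> sample_mean n (\<lambda>z. c) \<omega> = c"
  by (simp add: sample_mean_def sum_constant_scaleR)

lemma norm_sample_mean_le:
  "norm (sample_mean n f \<omega>) \<le> sample_mean n (\<lambda>z. norm (f z)) \<omega>"
  by (simp add: sample_mean_def norm_sum divide_simps mult.commute mult_left_mono)

lemma sample_mean_mono:
  fixes f g :: "'z \<Rightarrow> real"
  shows "(\<And>i. i < n \<Longrightarrow> f (obs i \<omega>) \<le> g (obs i \<omega>)) \<Longrightarrow> sample_mean n f \<omega> \<le> sample_mean n g \<omega>"
  by (auto simp: sample_mean_def intro!: mult_left_mono sum_mono)

lemma integrable_sample_mean:
  fixes f :: "'z \<Rightarrow> 'b::{banach, second_countable_topology}"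
  assumes "integrable F f" shows "integrable M (sample_mean n f)"
  using integrable_obs[OF assms] by (auto simp: sample_mean_def[abs_def])

lemma integral_sample_mean:
  fixes f :: "'z \<Rightarrow> real"
  assumes "integrable F f" "n \<noteq> 0"
  shows "(LINT \<omega>|M. sample_mean n f \<omega>) = (LINT z|F. f z)"
  using integrable_obs[OF assms(1)] assms(2)
  by (simp add: sample_mean_def Bochner_Integration.integral_sum)

text \<open>This is how the discarded tail is controlled in the law of large numbers below.\<close>

lemma L1_norm_sample_mean_le:
  fixes f :: "'z \<Rightarrow> real"
  assumes f: "integrable F f" and n: "n \<noteq> 0"
  shows "(LINT \<omega>|M. \<bar>sample_mean n f \<omega>\<bar>) \<le> (LINT z|F. \<bar>f z\<bar>)"
proof -
  have "(LINT \<omega>|M. \<bar>sample_mean n f \<omega>\<bar>) \<le> (LINT \<omega>|M. sample_mean n (\<lambda>z. \<bar>f z\<bar>) \<omega>)"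
    using f norm_sample_mean_le[of n f]
    by (intro integral_mono integrable_abs integrable_sample_mean) auto
  also have "\<dots> = (LINT z|F. \<bar>f z\<bar>)" using f n by (intro integral_sample_mean) auto
  finally show ?thesis .
qed

text \<open>By independence and centring the mixed terms of the expanded square vanish in expectation, and only \<open>n\<close> of the \<open>n\<^sup>2\<close> terms
  remain.\<close>

lemma integral_square_sample_mean_le:
  fixes g :: "'z \<Rightarrow> real"
  assumes [measurable]: "g \<in> borel_measurable F" and B: "\<And>z. \<bar>g z\<bar> \<le> B" and centred: "(LINT z|F. g z) = 0"
    and n: "n \<noteq> 0"
  shows "(LINT \<omega>|M. (sample_mean n g \<omega>)\<^sup>2) \<le> B\<^sup>2 / real n"
proof -
  let ?X = "\<lambda>i \<omega>. g (obs i \<omega>)"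
  interpret F: prob_space F by (rule prob_space_F)
  have intg: "integrable F g" by (rule F.integrable_const_bound[of _ B]) (auto simp: B)
  have B0: "0 \<le> B" using B[of undefined] by linarith
  have int: "integrable M (\<lambda>\<omega>. ?X i \<omega> * ?X j \<omega>)" for i j
    by (rule integrable_const_bound[of _ "B * B"]) (auto simp: abs_mult intro!: mult_mono B B0)
  have "(LINT \<omega>|M. ?X i \<omega> * ?X j \<omega>) \<le> (if i = j then B\<^sup>2 else 0)" for i j
  proof (cases "i = j")
    case True
    have "?X i \<omega> * ?X i \<omega> \<le> B\<^sup>2" for \<omega>
      using B[of "obs i \<omega>"] B0 abs_le_square_iff[of "?X i \<omega>" B] by (simp add: power2_eq_square)
    then have "(LINT \<omega>|M. ?X i \<omega> * ?X i \<omega>) \<le> (LINT \<omega>|M. B\<^sup>2)"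
      using int by (intro integral_mono) auto
    then show ?thesis using True by (simp add: prob_space)
  next
    case False
    have "indep_vars (\<lambda>_. borel) ?X {i, j}"
      using indep_vars_compose2[OF indep, of "\<lambda>_. g" "\<lambda>_. borel"]
      by (auto intro: indep_vars_subset)
    then have "(LINT \<omega>|M. (\<Prod>k\<in>{i, j}. ?X k \<omega>)) = (\<Prod>k\<in>{i, j}. LINT \<omega>|M. ?X k \<omega>)"
      using integrable_obs[OF intg] by (intro indep_vars_lebesgue_integral) auto
    then show ?thesis using False centred integrable_obs[OF intg] by simp
  qed note le = this
  have "(LINT \<omega>|M. (sample_mean n g \<omega>)\<^sup>2) = (LINT \<omega>|M. (\<Sum>i<n. \<Sum>j<n. ?X i \<omega> * ?X j \<omega>) / (real n)\<^sup>2)"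
    by (simp add: sample_mean_def sum_product[symmetric] power2_eq_square field_simps)
  also have "\<dots> = (\<Sum>i<n. \<Sum>j<n. LINT \<omega>|M. ?X i \<omega> * ?X j \<omega>) / (real n)\<^sup>2"
    using int by (simp add: Bochner_Integration.integral_sum)
  also have "\<dots> \<le> (\<Sum>i<n. \<Sum>j<n. if i = j then B\<^sup>2 else 0) / (real n)\<^sup>2"
    by (intro divide_right_mono sum_mono le) auto
  also have "\<dots> = B\<^sup>2 / real n" using n by (simp add: power2_eq_square)
  finally show ?thesis .
qed

lemma L1_sample_mean_bounded:
  fixes g :: "'z \<Rightarrow> real"
  assumes [measurable]: "g \<in> borel_measurable F" and B: "\<And>z. \<bar>g z\<bar> \<le> B" and centred: "(LINT z|F. g z) = 0"
  shows "(\<lambda>n. LINT \<omega>|M. \<bar>sample_mean n g \<omega>\<bar>) \<longlonglongrightarrow> 0"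
proof (rule tendstoI)
  fix e :: real assume e: "e > 0"
  interpret F: prob_space F by (rule prob_space_F)
  have intg: "integrable F g" by (rule F.integrable_const_bound[of _ B]) (auto simp: B)
  have meas[measurable]: "sample_mean n g \<in> borel_measurable M" for n
    using integrable_sample_mean[OF intg] by auto
  have bnd: "\<bar>sample_mean n g \<omega>\<bar> \<le> B" if "n \<noteq> 0" for n \<omega>
    using norm_sample_mean_le[of n g \<omega>] sample_mean_mono[of n "\<lambda>z. \<bar>g z\<bar>" \<omega> "\<lambda>_. B"] B
      sample_mean_const[OF that, of B \<omega>] by auto
  have int2: "integrable M (\<lambda>\<omega>. (sample_mean n g \<omega>)\<^sup>2)" if "n \<noteq> 0" for n
  proof (rule integrable_const_bound[of _ "B\<^sup>2"])
    show "AE \<omega> in M. norm ((sample_mean n g \<omega>)\<^sup>2) \<le> B\<^sup>2"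
      using power_mono[OF bnd[OF that] abs_ge_zero, where n=2] by simp
  qed measurable
  obtain k :: nat where k: "B\<^sup>2 / (e/2)\<^sup>2 < real k" using reals_Archimedean2 by blast
  show "\<forall>\<^sub>F n in sequentially. dist (LINT \<omega>|M. \<bar>sample_mean n g \<omega>\<bar>) 0 < e"
    using eventually_gt_at_top[of k]
  proof eventually_elim
    fix n assume nk: "k < n"
    then have n: "n \<noteq> 0" by auto
    \<comment> \<open>Young's inequality turns the bound on the second moment into one on the first moment.\<close>
    have young: "\<bar>y\<bar> \<le> e / 2 + y\<^sup>2 / (e / 2)" for y
    proof (cases "\<bar>y\<bar> \<le> e / 2")
      case True
      moreover have "0 \<le> y\<^sup>2 / (e / 2)" using e by simp
      ultimately show ?thesis by linarith
    next
      case False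
      then have "\<bar>y\<bar> * (e / 2) \<le> \<bar>y\<bar> * \<bar>y\<bar>" by (intro mult_left_mono) auto
      then have "\<bar>y\<bar> \<le> y\<^sup>2 / (e / 2)" using e by (simp add: field_simps power2_eq_square)
      then show ?thesis using e by linarith
    qed
    have "(LINT \<omega>|M. \<bar>sample_mean n g \<omega>\<bar>) \<le> (LINT \<omega>|M. e / 2 + (sample_mean n g \<omega>)\<^sup>2 / (e / 2))"
      using young int2[OF n] intg
      by (intro integral_mono integrable_abs integrable_sample_mean Bochner_Integration.integrable_add integrable_divide) auto
    also have "\<dots> = e / 2 + (LINT \<omega>|M. (sample_mean n g \<omega>)\<^sup>2) / (e / 2)"
      using int2[OF n] by (subst Bochner_Integration.integral_add) (auto simp: prob_space)
    also have "\<dots> \<le> e / 2 + (B\<^sup>2 / real n) / (e / 2)"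
      using e integral_square_sample_mean_le[OF _ B centred n] by (intro add_left_mono divide_right_mono) auto
    also have "\<dots> < e / 2 + e / 2"
    proof -
      have "B\<^sup>2 / (e/2)\<^sup>2 < real n" using k nk by linarith
      then have "B\<^sup>2 < real n * (e/2)\<^sup>2" using e by (simp add: divide_less_eq)
      then show ?thesis using e n by (simp add: field_simps power2_eq_square)
    qed
    finally show "dist (LINT \<omega>|M. \<bar>sample_mean n g \<omega>\<bar>) 0 < e" by simp
  qed
qed

text \<open>The summands are merely integrable, so that the second moment bound applies only after truncation at a
  level \<open>m\<close>. The truncated part is handled by the bounded case; the tail contributes at most twice its own
  \<open>L\<^sub>1\<close> norm, uniformly in the sample size, and that norm tends to \<open>0\<close> as \<open>m\<close> grows.\<close>

lemma weak_law_L1: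
  fixes f :: "'z \<Rightarrow> real"
  assumes f: "integrable F f"
  shows "(\<lambda>n. LINT \<omega>|M. \<bar>sample_mean n f \<omega> - (LINT z|F. f z)\<bar>) \<longlonglongrightarrow> 0"
proof (rule tendstoI)
  fix e :: real assume e: "e > 0"
  interpret F: prob_space F by (rule prob_space_F)
  have [measurable]: "f \<in> borel_measurable F" using f by auto
  define cut where "cut m z = (if \<bar>f z\<bar> \<le> real m then f z else 0)" for m :: nat and z
  have [measurable]: "cut m \<in> borel_measurable F" for m unfolding cut_def by measurable
  have cut_le: "\<bar>cut m z\<bar> \<le> real m" for m z by (simp add: cut_def)
  have intcut: "integrable F (cut m)" for m
    by (rule F.integrable_const_bound[of _ m]) (auto simp: cut_le)
  have "(\<lambda>m. LINT z|F. \<bar>f z - cut m z\<bar>) \<longlonglongrightarrow> (LINT z|F. 0)"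
  proof (rule integral_dominated_convergence)
    show "integrable F (\<lambda>z. \<bar>f z\<bar>)" using f by simp
    show "AE z in F. (\<lambda>m. \<bar>f z - cut m z\<bar>) \<longlonglongrightarrow> 0"
    proof (intro AE_I2 tendsto_eventually)
      fix z
      obtain k :: nat where k: "\<bar>f z\<bar> < real k" using reals_Archimedean2 by blast
      show "\<forall>\<^sub>F m in sequentially. \<bar>f z - cut m z\<bar> = 0"
        using eventually_ge_at_top[of k] by eventually_elim (use k in \<open>auto simp: cut_def\<close>)
    qed
  qed (auto simp: cut_def)
  then have "\<forall>\<^sub>F m in sequentially. (LINT z|F. \<bar>f z - cut m z\<bar>) < e / 3"
    by (intro order_tendstoD(2)) (use e in auto)
  then obtain m where m: "(LINT z|F. \<bar>f z - cut m z\<bar>) < e / 3"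
    by (meson eventually_happens' sequentially_bot)
  define g where "g z = cut m z - (LINT z|F. cut m z)" for z
  have intg: "integrable F g" using intcut by (simp add: g_def[abs_def])
  have "\<bar>LINT z|F. cut m z\<bar> \<le> (LINT z|F. \<bar>cut m z\<bar>)" by (rule integral_abs_bound)
  also have "\<dots> \<le> (LINT z|F. real m)" using intcut cut_le by (intro integral_mono) auto
  finally have ms: "\<bar>LINT z|F. cut m z\<bar> \<le> m" by (simp add: F.prob_space)
  have "(\<lambda>n. LINT \<omega>|M. \<bar>sample_mean n g \<omega>\<bar>) \<longlonglongrightarrow> 0"
  proof (rule L1_sample_mean_bounded)
    show "\<bar>g z\<bar> \<le> 2 * real m" for z using cut_le[of m z] ms by (simp add: g_def)
    show "(LINT z|F. g z) = 0" using intcut by (simp add: g_def F.prob_space)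
  qed (simp add: g_def[abs_def])
  then have "\<forall>\<^sub>F n in sequentially. (LINT \<omega>|M. \<bar>sample_mean n g \<omega>\<bar>) < e / 3"
    by (rule order_tendstoD) (use e in auto)
  then show "\<forall>\<^sub>F n in sequentially. dist (LINT \<omega>|M. \<bar>sample_mean n f \<omega> - (LINT z|F. f z)\<bar>) 0 < e"
    using eventually_gt_at_top[of 0]
  proof eventually_elim
    fix n :: nat assume n: "(LINT \<omega>|M. \<bar>sample_mean n g \<omega>\<bar>) < e / 3" "0 < n"
    let ?r = "\<lambda>z. f z - cut m z"
    have intr: "integrable F ?r" using f intcut by simp
    have eq: "sample_mean n f \<omega> - (LINT z|F. f z) = sample_mean n ?r \<omega> + sample_mean n g \<omega> - (LINT z|F. ?r z)" for \<omega>
      using f intcut n(2) by (simp add: sample_mean_diff g_def[abs_def] sample_mean_const)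
    have "(LINT \<omega>|M. \<bar>sample_mean n f \<omega> - (LINT z|F. f z)\<bar>) \<le>
        (LINT \<omega>|M. \<bar>sample_mean n ?r \<omega>\<bar> + \<bar>sample_mean n g \<omega>\<bar> + \<bar>LINT z|F. ?r z\<bar>)"
      unfolding eq using intr intg f intcut
      by (intro integral_mono Bochner_Integration.integrable_add integrable_abs Bochner_Integration.integrable_diff integrable_sample_mean) auto
    also have "\<dots> = (LINT \<omega>|M. \<bar>sample_mean n ?r \<omega>\<bar>) + (LINT \<omega>|M. \<bar>sample_mean n g \<omega>\<bar>) + \<bar>LINT z|F. ?r z\<bar>"
      using integrable_sample_mean[OF intr] integrable_sample_mean[OF intg] by (simp add: prob_space)
    also have "\<dots> \<le> (LINT z|F. \<bar>?r z\<bar>) + (LINT \<omega>|M. \<bar>sample_mean n g \<omega>\<bar>) + (LINT z|F. \<bar>?r z\<bar>)"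
      using n intr by (intro add_mono L1_norm_sample_mean_le integral_abs_bound) auto
    also have "\<dots> < e" using m n by linarith
    finally show "dist (LINT \<omega>|M. \<bar>sample_mean n f \<omega> - (LINT z|F. f z)\<bar>) 0 < e" by simp
  qed
qed

lemma tendsto_sample_mean:
  fixes f :: "'z \<Rightarrow> 'b::euclidean_space"
  assumes f: "integrable F f"
  shows "((\<lambda>(n, \<omega>). sample_mean n f \<omega>) \<longlongrightarrow> (LINT z|F. f z)) (high_prob M)"
  unfolding tendsto_componentwise_iff[of _ "LINT z|F. f z"]
proof
  fix b :: 'b assume "b \<in> Basis"
  have fb: "integrable F (\<lambda>z. f z \<bullet> b)" using f by (rule integrable_inner_left)
  have "((\<lambda>(n, \<omega>). sample_mean n (\<lambda>z. f z \<bullet> b) \<omega> - (LINT z|F. f z \<bullet> b)) \<longlongrightarrow> 0) (high_prob M)"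
    using integrable_sample_mean[OF fb] weak_law_L1[OF fb]
    by (intro tendsto_high_prob_L1) auto
  then have "((\<lambda>x. (case x of (n, \<omega>) \<Rightarrow> sample_mean n (\<lambda>z. f z \<bullet> b) \<omega> - (LINT z|F. f z \<bullet> b)) + (LINT z|F. f z \<bullet> b))
      \<longlongrightarrow> 0 + (LINT z|F. f z \<bullet> b)) (high_prob M)"
    by (intro tendsto_add tendsto_const)
  moreover have "sample_mean n (\<lambda>z. f z \<bullet> b) \<omega> = sample_mean n f \<omega> \<bullet> b" for n \<omega>
    by (simp add: sample_mean_def inner_sum_left)
  ultimately show "((\<lambda>x. (case x of (n, \<omega>) \<Rightarrow> sample_mean n f \<omega>) \<bullet> b) \<longlongrightarrow> (LINT z|F. f z) \<bullet> b) (high_prob M)"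
    using f by (simp add: case_prod_unfold)
qed

end

section \<open>Uniform laws for dominated families\<close>

text \<open>For every \<open>z\<close> the values \<open>g z s\<close> are small for \<open>s\<close> near \<open>a\<close>, but how near depends on \<open>z\<close>. The supremum of
  \<open>g z\<close> over a ball around \<open>a\<close> tends to \<open>0\<close> with the radius for every \<open>z\<close> and is dominated by \<open>G\<close>, so its
  expectation tends to \<open>0\<close> too. By continuity of \<open>g z\<close> the supremum over a countable dense subset \<open>D\<close> is the same;
  this makes it measurable. Both uniform limit theorems below rest on the law of large numbers for the single
  function \<open>w\<close>.\<close>

lemma dominated_modulus:
  fixes g :: "'z \<Rightarrow> 'a::euclidean_space \<Rightarrow> real"
  assumes a: "a \<notin> S"
    and meas: "\<And>s. s \<in> S \<Longrightarrow> (\<lambda>z. g z s) \<in> borel_measurable F"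
    and nonneg: "\<And>z s. 0 \<le> g z s"
    and cont: "\<And>z. z \<in> space F \<Longrightarrow> continuous_on S (g z)"
    and lim: "\<And>z. z \<in> space F \<Longrightarrow> (g z \<longlongrightarrow> 0) (at a within S)"
    and G: "integrable F G" and dom: "AE z in F. \<forall>s\<in>S. g z s \<le> G z"
    and e: "e > 0"
  obtains d w where "d > 0" "integrable F w" "\<And>z. 0 \<le> w z" "(LINT z|F. w z) < e"
    "AE z in F. \<forall>s\<in>S. dist s a < d \<longrightarrow> g z s \<le> w z"
proof -
  obtain D where D: "countable D" "D \<subseteq> S" "S \<subseteq> closure D" by (rule separable)
  \<comment> \<open>The supremum is formed in the extended reals, where it always exists and is measurable; it is finite only
    almost everywhere.\<close>
  define W where "W k z = (SUP s\<in>{s\<in>D. dist s a < 1 / real (Suc k)}. ennreal (g z s))" for k z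
  define w where "w k z = enn2real (W k z)" for k z
  have [measurable]: "W k \<in> borel_measurable F" for k
    unfolding W_def using D meas
    by (intro borel_measurable_SUP) (auto intro!: measurable_compose[OF _ measurable_ennreal])
  have meas_w[measurable]: "w k \<in> borel_measurable F" for k unfolding w_def[abs_def] by measurable
  have w_le: "w k z \<le> c" if "0 \<le> c" "\<And>s. s \<in> S \<Longrightarrow> dist s a < 1 / real (Suc k) \<Longrightarrow> g z s \<le> c" for k z c
    unfolding w_def W_def using that D by (intro enn2real_leI SUP_least ennreal_leI) auto
  have bound: "AE z in F. norm (w k z) \<le> norm (G z)" for k
    using dom
  proof eventually_elim
    case (elim z)
    have "w k z \<le> \<bar>G z\<bar>" by (rule w_le) (use elim in \<open>auto intro: order_trans[OF _ abs_ge_self]\<close>)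
    moreover have "0 \<le> w k z" by (simp add: w_def)
    ultimately show ?case by simp
  qed
  have intG: "integrable F (\<lambda>z. norm (G z))" using G by simp
  have lim_w: "(\<lambda>k. w k z) \<longlonglongrightarrow> 0" if z: "z \<in> space F" for z
  proof (rule tendstoI)
    fix r :: real assume r: "r > 0"
    then have "\<forall>\<^sub>F s in at a within S. g z s < r / 2" by (intro order_tendstoD(2)[OF lim[OF z]]) auto
    then obtain \<delta> where \<delta>: "\<delta> > 0" "\<And>s. s \<in> S \<Longrightarrow> dist s a < \<delta> \<Longrightarrow> g z s < r / 2"
      using a unfolding eventually_at by metis
    have "\<forall>\<^sub>F k in sequentially. 1 / real (Suc k) < \<delta>"
      using \<delta>(1) by (intro order_tendstoD(2)[OF lim_inverse_n'[THEN LIMSEQ_Suc]])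
    then show "\<forall>\<^sub>F k in sequentially. dist (w k z) 0 < r"
    proof eventually_elim
      fix k assume k: "1 / real (Suc k) < \<delta>"
      have "w k z \<le> r / 2" using \<delta>(2) k r by (intro w_le less_imp_le) auto
      then show "dist (w k z) 0 < r" using r by (simp add: w_def)
    qed
  qed
  have "(\<lambda>k. LINT z|F. w k z) \<longlonglongrightarrow> (LINT z|F. 0)"
    by (rule integral_dominated_convergence[OF _ meas_w intG _ bound]) (auto intro: AE_I2 lim_w)
  then have "\<forall>\<^sub>F k in sequentially. (LINT z|F. w k z) < e"
    by (intro order_tendstoD(2)) (use e in auto)
  then obtain k where k: "(LINT z|F. w k z) < e" by (meson eventually_happens' sequentially_bot)
  show thesis
  proof (rule that)
    show "1 / real (Suc k) > 0" by simp
    show "integrable F (w k)" by (rule Bochner_Integration.integrable_bound[OF G meas_w bound])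
    show "AE z in F. \<forall>s\<in>S. dist s a < 1 / real (Suc k) \<longrightarrow> g z s \<le> w k z"
      using dom AE_space
    proof eventually_elim
      fix z assume dom: "\<forall>s\<in>S. g z s \<le> G z" and z: "z \<in> space F"
      have "W k z \<le> ennreal (G z)"
        unfolding W_def using dom D by (intro SUP_least ennreal_leI) auto
      then have fin: "W k z < top" by (rule le_less_trans) simp
      have on_D: "g z s \<le> w k z" if "s \<in> D" "dist s a < 1 / real (Suc k)" for s
      proof -
        have "ennreal (g z s) \<le> W k z" unfolding W_def using that by (intro SUP_upper) auto
        then have "enn2real (ennreal (g z s)) \<le> w k z" unfolding w_def using fin by (intro enn2real_mono)
        then show ?thesis using nonneg by simp
      qed
      show "\<forall>s\<in>S. dist s a < 1 / real (Suc k) \<longrightarrow> g z s \<le> w k z"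
      proof (intro ballI impI)
        fix s assume s: "s \<in> S" "dist s a < 1 / real (Suc k)"
        then obtain x where x: "\<And>i. x i \<in> D" "x \<longlonglongrightarrow> s"
          using D(3) closure_sequential[of s D] by auto
        have "(\<lambda>i. g z (x i)) \<longlonglongrightarrow> g z s"
          by (rule continuous_on_tendsto_compose[OF cont[OF z] x(2) s(1)]) (use x(1) D(2) in \<open>auto intro!: always_eventually\<close>)
        moreover have "\<forall>\<^sub>F i in sequentially. dist (x i) a < 1 / real (Suc k)"
          using s(2) by (intro order_tendstoD(2)[OF tendsto_dist[OF x(2) tendsto_const]])
        then have "\<forall>\<^sub>F i in sequentially. g z (x i) \<le> w k z"
          by eventually_elim (use x(1) on_D in auto)
        ultimately show "g z s \<le> w k z" by (intro tendsto_upperbound) auto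
      qed
    qed
  qed (use k in \<open>auto simp: w_def\<close>)
qed

context iid_sample
begin

lemma eventually_sample_mean_less:
  fixes w :: "'z \<Rightarrow> real"
  assumes "integrable F w" "(LINT z|F. w z) < e"
  shows "eventually (\<lambda>(n, \<omega>). sample_mean n w \<omega> < e) (high_prob M)"
  using order_tendstoD(2)[OF tendsto_sample_mean[OF assms(1)] assms(2)] by (simp add: case_prod_unfold)

lemma eventually_obs:
  assumes "AE z in F. Q z"
  shows "eventually (\<lambda>(n, \<omega>). n \<noteq> 0 \<and> \<omega> \<in> space M \<and> (\<forall>i. Q (obs i \<omega>))) (high_prob M)"
  by (rule eventually_high_prob_AE[of 1]) (use AE_obs[OF assms] AE_space in eventually_elim, auto)

text \<open>Near \<open>a\<close> both the sample mean and the expectation of \<open>f\<close> at \<open>s\<close> differ from their values at \<open>a\<close> by less than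
  \<open>e / 3\<close>: the former by the sample mean of the modulus \<open>w\<close>, the latter by its expectation.\<close>

lemma uniform_law_local:
  fixes f :: "'z \<Rightarrow> 'a::euclidean_space \<Rightarrow> 'b::euclidean_space"
  assumes a: "a \<in> S" and int: "\<And>s. s \<in> S \<Longrightarrow> integrable F (\<lambda>z. f z s)"
    and cont: "\<And>z. z \<in> space F \<Longrightarrow> continuous_on S (f z)"
    and U: "open U" "a \<in> U" and G: "integrable F G"
    and dom: "AE z in F. \<forall>s\<in>U \<inter> S. norm (f z s) \<le> G z"
    and e: "e > 0"
  shows "\<exists>d>0. eventually (\<lambda>(n, \<omega>). \<forall>s\<in>S \<inter> ball a d.
    dist (sample_mean n (\<lambda>z. f z s) \<omega>) (LINT z|F. f z s) < e) (high_prob M)"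
proof -
  obtain d w where dw: "d > 0" "integrable F w" "\<And>z. 0 \<le> w z" "(LINT z|F. w z) < e / 3"
    "AE z in F. \<forall>s\<in>U \<inter> S - {a}. dist s a < d \<longrightarrow> norm (f z s - f z a) \<le> w z"
  proof (rule dominated_modulus[of a "U \<inter> S - {a}" "\<lambda>z s. norm (f z s - f z a)" F "\<lambda>z. 2 * G z" "e / 3"])
    show "(\<lambda>z. norm (f z s - f z a)) \<in> borel_measurable F" if "s \<in> U \<inter> S - {a}" for s
    proof -
      have [measurable]: "(\<lambda>z. f z s) \<in> borel_measurable F" "(\<lambda>z. f z a) \<in> borel_measurable F"
        using that a int by (blast intro: borel_measurable_integrable)+
      show ?thesis by measurable
    qed
    show "continuous_on (U \<inter> S - {a}) (\<lambda>s. norm (f z s - f z a))" if "z \<in> space F" for z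
      by (intro continuous_intros continuous_on_subset[OF cont[OF that]]) auto
    show "((\<lambda>s. norm (f z s - f z a)) \<longlongrightarrow> 0) (at a within U \<inter> S - {a})" if "z \<in> space F" for z
    proof -
      have "(f z \<longlongrightarrow> f z a) (at a within S)" using cont[OF that] a by (simp add: continuous_on_def)
      then have "(f z \<longlongrightarrow> f z a) (at a within U \<inter> S - {a})" by (rule tendsto_within_subset) auto
      then show ?thesis using tendsto_norm[OF LIM_zero] by fastforce
    qed
    show "AE z in F. \<forall>s\<in>U \<inter> S - {a}. norm (f z s - f z a) \<le> 2 * G z"
      using dom
    proof eventually_elim
      fix z assume *: "\<forall>s\<in>U \<inter> S. norm (f z s) \<le> G z"
      show "\<forall>s\<in>U \<inter> S - {a}. norm (f z s - f z a) \<le> 2 * G z"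
      proof
        fix s assume "s \<in> U \<inter> S - {a}"
        then have "norm (f z s) \<le> G z" "norm (f z a) \<le> G z" using * a U by auto
        then show "norm (f z s - f z a) \<le> 2 * G z" using norm_triangle_ineq4[of "f z s" "f z a"] by linarith
      qed
    qed
  qed (use G e in auto)
  obtain r where r: "r > 0" "ball a r \<subseteq> U" using U by (meson open_contains_ball)
  define \<delta> where "\<delta> = min d r"
  have modulus: "AE z in F. \<forall>s\<in>S \<inter> ball a \<delta>. norm (f z s - f z a) \<le> w z"
    using dw(5)
  proof eventually_elim
    case (elim z)
    show ?case
    proof
      fix s assume s: "s \<in> S \<inter> ball a \<delta>"
      show "norm (f z s - f z a) \<le> w z"
      proof (cases "s = a")
        case False
        have "s \<in> ball a r" using s by (auto simp: \<delta>_def)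
        then have "s \<in> U \<inter> S - {a}" "dist s a < d" using s r False by (auto simp: \<delta>_def dist_commute)
        with elim show ?thesis by blast
      qed (use dw(3) in auto)
    qed
  qed
  have exp_close: "norm ((LINT z|F. f z s) - (LINT z|F. f z a)) < e / 3" if s: "s \<in> S \<inter> ball a \<delta>" for s
  proof -
    have intd: "integrable F (\<lambda>z. f z s - f z a)" using int a s by auto
    have "norm ((LINT z|F. f z s) - (LINT z|F. f z a)) = norm (LINT z|F. f z s - f z a)"
      using int a s by simp
    also have "\<dots> \<le> (LINT z|F. norm (f z s - f z a))" by (rule integral_norm_bound)
    also have "\<dots> \<le> (LINT z|F. w z)"
    proof (intro integral_mono_AE integrable_norm intd dw(2))
      show "AE z in F. norm (f z s - f z a) \<le> w z" using modulus by eventually_elim (use s in blast)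
    qed
    finally show ?thesis using dw(4) by simp
  qed
  have "eventually (\<lambda>(n, \<omega>). dist (sample_mean n (\<lambda>z. f z a) \<omega>) (LINT z|F. f z a) < e / 3) (high_prob M)"
    using tendstoD[OF tendsto_sample_mean[OF int[OF a]], of "e / 3"] e by (simp add: case_prod_unfold)
  with eventually_sample_mean_less[OF dw(2,4)] eventually_obs[OF modulus]
  have "eventually (\<lambda>(n, \<omega>). \<forall>s\<in>S \<inter> ball a \<delta>.
    dist (sample_mean n (\<lambda>z. f z s) \<omega>) (LINT z|F. f z s) < e) (high_prob M)"
  proof eventually_elim
    case (elim x)
    obtain n \<omega> where x: "x = (n, \<omega>)" by (cases x)
    have "dist (sample_mean n (\<lambda>z. f z s) \<omega>) (LINT z|F. f z s) < e" if s: "s \<in> S \<inter> ball a \<delta>" for s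
    proof -
      have "norm (sample_mean n (\<lambda>z. f z s) \<omega> - sample_mean n (\<lambda>z. f z a) \<omega>) \<le>
          sample_mean n (\<lambda>z. norm (f z s - f z a)) \<omega>"
        unfolding sample_mean_diff[symmetric] by (rule norm_sample_mean_le)
      also have "\<dots> \<le> sample_mean n w \<omega>" using elim s x by (intro sample_mean_mono) auto
      also have "\<dots> < e / 3" using elim x by simp
      finally have "dist (sample_mean n (\<lambda>z. f z s) \<omega>) (sample_mean n (\<lambda>z. f z a) \<omega>) < e / 3"
        by (simp add: dist_norm)
      moreover have "dist (sample_mean n (\<lambda>z. f z a) \<omega>) (LINT z|F. f z a) < e / 3" using elim x by simp
      moreover have "dist (LINT z|F. f z s) (LINT z|F. f z a) < e / 3" using exp_close[OF s] by (simp add: dist_norm)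
      ultimately show ?thesis by metric
    qed
    then show ?case by (simp add: x)
  qed
  moreover have "\<delta> > 0" using dw(1) r(1) by (simp add: \<delta>_def)
  ultimately show ?thesis by blast
qed

text \<open>A uniform law of large numbers: finitely many of the balls from the local version cover \<open>S\<close>.\<close>

lemma uniform_law:
  fixes f :: "'z \<Rightarrow> 'a::euclidean_space \<Rightarrow> 'b::euclidean_space"
  assumes S: "compact S" and int: "\<And>s. s \<in> S \<Longrightarrow> integrable F (\<lambda>z. f z s)"
    and cont: "\<And>z. z \<in> space F \<Longrightarrow> continuous_on S (f z)"
    and dom: "\<And>a. a \<in> S \<Longrightarrow> \<exists>U G. open U \<and> a \<in> U \<and> integrable F G \<and> (AE z in F. \<forall>s\<in>U \<inter> S. norm (f z s) \<le> G z)"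
    and e: "e > 0"
  shows "eventually (\<lambda>(n, \<omega>). \<forall>s\<in>S. dist (sample_mean n (\<lambda>z. f z s) \<omega>) (LINT z|F. f z s) < e) (high_prob M)"
proof -
  let ?Q = "\<lambda>B x. \<forall>s\<in>S \<inter> B. dist (sample_mean (fst x) (\<lambda>z. f z s) (snd x)) (LINT z|F. f z s) < e"
  have "\<forall>a\<in>S. \<exists>d>0. eventually (?Q (ball a d)) (high_prob M)"
  proof
    fix a assume a: "a \<in> S"
    then obtain U G where "open U" "a \<in> U" "integrable F G" "AE z in F. \<forall>s\<in>U \<inter> S. norm (f z s) \<le> G z"
      using dom by blast
    from uniform_law_local[OF a int cont this e]
    show "\<exists>d>0. eventually (?Q (ball a d)) (high_prob M)" by (simp add: case_prod_unfold)
  qed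
  from bchoice[OF this] obtain d
    where d: "\<And>a. a \<in> S \<Longrightarrow> d a > 0 \<and> eventually (?Q (ball a (d a))) (high_prob M)" by blast
  obtain A where A: "A \<subseteq> S" "finite A" "S \<subseteq> (\<Union>a\<in>A. ball a (d a))"
    by (rule compactE_image[OF S, of S "\<lambda>a. ball a (d a)"]) (use d in auto)
  have "eventually (\<lambda>x. \<forall>a\<in>A. ?Q (ball a (d a)) x) (high_prob M)"
    using A d by (intro eventually_ball_finite) auto
  then show ?thesis
  proof eventually_elim
    case (elim x)
    have "dist (sample_mean (fst x) (\<lambda>z. f z s) (snd x)) (LINT z|F. f z s) < e" if s: "s \<in> S" for s
    proof -
      obtain a where "a \<in> A" "s \<in> ball a (d a)" using A(3) s by blast
      then show ?thesis using elim s by blast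
    qed
    then show ?case by (simp add: case_prod_unfold)
  qed
qed

text \<open>A random linear map is a linear combination of its values on the finite basis, so its sample mean converges
  in operator norm.\<close>

lemma eventually_linear_mean_close:
  fixes D :: "'z \<Rightarrow> 'a::euclidean_space \<Rightarrow> 'b::euclidean_space"
  assumes lin: "\<And>z. z \<in> space F \<Longrightarrow> linear (D z)" and int: "\<And>h. integrable F (\<lambda>z. D z h)"
    and e: "e > 0"
  shows "eventually (\<lambda>(n, \<omega>). \<forall>h. norm (sample_mean n (\<lambda>z. D z h) \<omega> - (LINT z|F. D z h)) \<le> e * norm h)
    (high_prob M)"
proof -
  let ?E = "\<lambda>h x. sample_mean (fst x) (\<lambda>z. D z h) (snd x) - (LINT z|F. D z h)"
  have expand: "D z h = (\<Sum>b\<in>Basis. (h \<bullet> b) *\<^sub>R D z b)" if "z \<in> space F" for z h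
    using linear_sum[OF lin[OF that], of "\<lambda>b. (h \<bullet> b) *\<^sub>R b" Basis] linear_scale[OF lin[OF that]]
    by (simp add: euclidean_representation)
  have int_expand: "(LINT z|F. D z h) = (\<Sum>b\<in>Basis. (h \<bullet> b) *\<^sub>R (LINT z|F. D z b))" for h
  proof -
    have "(LINT z|F. D z h) = (LINT z|F. (\<Sum>b\<in>Basis. (h \<bullet> b) *\<^sub>R D z b))"
      by (intro Bochner_Integration.integral_cong refl expand)
    then show ?thesis using int by (simp add: Bochner_Integration.integral_sum)
  qed
  have "((\<lambda>x. \<Sum>b\<in>Basis. norm (?E b x)) \<longlongrightarrow> (\<Sum>b\<in>(Basis :: 'a set). 0)) (high_prob M)"
  proof (rule tendsto_sum)
    fix b :: 'a
    show "((\<lambda>x. norm (?E b x)) \<longlongrightarrow> 0) (high_prob M)"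
      using tendsto_norm[OF LIM_zero[OF tendsto_sample_mean[OF int[of b]]]] by (simp add: case_prod_unfold)
  qed
  then have "eventually (\<lambda>x. (\<Sum>b\<in>Basis. norm (?E b x)) < e) (high_prob M)"
    by (rule order_tendstoD(2)) (use e in simp)
  moreover have "eventually (\<lambda>x. snd x \<in> space M) (high_prob M)"
    by (rule eventually_high_prob_AE[of 0]) (use AE_space in auto)
  ultimately show ?thesis
  proof eventually_elim
    case (elim x)
    have "norm (?E h x) \<le> e * norm h" for h
    proof -
      have "sample_mean (fst x) (\<lambda>z. D z h) (snd x) = 
          (\<Sum>b\<in>Basis. (h \<bullet> b) *\<^sub>R sample_mean (fst x) (\<lambda>z. D z b) (snd x))"
      proof -
        have "(\<Sum>i<fst x. D (obs i (snd x)) h) = (\<Sum>i<fst x. \<Sum>b\<in>Basis. (h \<bullet> b) *\<^sub>R D (obs i (snd x)) b)"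
          by (intro sum.cong refl expand obs_in_space elim)
        also have "\<dots> = (\<Sum>b\<in>Basis. (h \<bullet> b) *\<^sub>R (\<Sum>i<fst x. D (obs i (snd x)) b))"
          by (subst sum.swap) (simp add: scaleR_sum_right)
        finally show ?thesis by (simp add: sample_mean_def scaleR_sum_right mult.commute)
      qed
      then have "?E h x = (\<Sum>b\<in>Basis. (h \<bullet> b) *\<^sub>R ?E b x)"
        by (simp add: int_expand[of h] scaleR_diff_right sum_subtractf)
      then have "norm (?E h x) \<le> (\<Sum>b\<in>Basis. norm ((h \<bullet> b) *\<^sub>R ?E b x))" by (simp only: norm_sum)
      also have "\<dots> \<le> (\<Sum>b\<in>Basis. norm h * norm (?E b x))"
        by (intro sum_mono) (auto intro!: mult_right_mono Basis_le_norm)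
      also have "\<dots> = norm h * (\<Sum>b\<in>Basis. norm (?E b x))" by (simp add: sum_distrib_left)
      also have "\<dots> \<le> norm h * e" using elim by (intro mult_left_mono) auto
      finally show ?thesis by (simp add: mult.commute)
    qed
    then show ?case by (simp add: case_prod_unfold)
  qed
qed

text \<open>The mean of the linearization errors \<open>f z s - f z a - f' z a (s - a)\<close>, divided by \<open>norm (s - a)\<close>, is controlled
  by one modulus \<open>w\<close> with small expectation: the quotients tend to \<open>0\<close> by differentiability, and the mean value
  inequality on the ball bounds them by \<open>2 G\<close>. The mean of the derivatives at \<open>a\<close> is then replaced by its
  expectation.\<close>

lemma uniform_linearization:
  fixes f :: "'z \<Rightarrow> 'a::euclidean_space \<Rightarrow> 'b::euclidean_space"
  assumes r: "r > 0"
    and der: "\<And>z s. z \<in> space F \<Longrightarrow> s \<in> ball a r \<Longrightarrow> (f z has_derivative f' z s) (at s)"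
    and int: "\<And>s. s \<in> ball a r \<Longrightarrow> integrable F (\<lambda>z. f z s)" "\<And>h. integrable F (\<lambda>z. f' z a h)"
    and G: "integrable F G" and dom: "AE z in F. \<forall>s\<in>ball a r. \<forall>h. norm (f' z s h) \<le> G z * norm h"
    and e: "e > 0"
  obtains d where "d > 0" "eventually (\<lambda>(n, \<omega>). \<forall>s\<in>ball a d.
      norm (sample_mean n (\<lambda>z. f z s) \<omega> - sample_mean n (\<lambda>z. f z a) \<omega> - (LINT z|F. f' z a (s - a)))
        \<le> e * norm (s - a)) (high_prob M)"
proof -
  let ?R = "\<lambda>z s. f z s - f z a - f' z a (s - a)"
  have a: "a \<in> ball a r" using r by simp
  have lin: "bounded_linear (f' z a)" if "z \<in> space F" for z
    using der[OF that a] by (rule has_derivative_bounded_linear)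
  obtain d w where dw: "d > 0" "integrable F w" "\<And>z. 0 \<le> w z" "(LINT z|F. w z) < e / 2"
    "AE z in F. \<forall>s\<in>ball a r - {a}. dist s a < d \<longrightarrow> norm (?R z s) / norm (s - a) \<le> w z"
  proof (rule dominated_modulus[of a "ball a r - {a}" "\<lambda>z s. norm (?R z s) / norm (s - a)" F "\<lambda>z. 2 * G z" "e / 2"])
    show "(\<lambda>z. norm (?R z s) / norm (s - a)) \<in> borel_measurable F" if "s \<in> ball a r - {a}" for s
      using that int[THEN borel_measurable_integrable] a
      by (intro borel_measurable_divide borel_measurable_norm borel_measurable_diff borel_measurable_const) auto
    show "continuous_on (ball a r - {a}) (\<lambda>s. norm (?R z s) / norm (s - a))" if z: "z \<in> space F" for z
    proof -
      have "continuous_on (ball a r) (f z)"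
        using der[OF z] by (meson continuous_at_imp_continuous_on has_derivative_continuous)
      then show ?thesis
        by (intro continuous_intros bounded_linear.continuous_on[OF lin[OF z]]) (auto intro: continuous_on_subset)
    qed
    show "((\<lambda>s. norm (?R z s) / norm (s - a)) \<longlongrightarrow> 0) (at a within ball a r - {a})" if z: "z \<in> space F" for z
      using has_derivative_at_withinI[OF der[OF z a]] unfolding has_derivative_iff_norm by blast
    show "AE z in F. \<forall>s\<in>ball a r - {a}. norm (?R z s) / norm (s - a) \<le> 2 * G z"
      using dom AE_space
    proof eventually_elim
      case (elim z)
      show ?case
      proof
        fix s assume s: "s \<in> ball a r - {a}"
        have "norm (f z s - f z a) \<le> G z * norm (s - a)"
        proof (rule differentiable_bound[OF convex_ball])
          show "(f z has_derivative f' z t) (at t within ball a r)" if "t \<in> ball a r" for t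
            using der[OF elim(2) that] by (rule has_derivative_at_withinI)
          show "onorm (f' z t) \<le> G z" if "t \<in> ball a r" for t
            using elim(1) that by (intro onorm_le) auto
        qed (use s a in auto)
        moreover have "norm (f' z a (s - a)) \<le> G z * norm (s - a)" using elim(1) a by blast
        ultimately have "norm (?R z s) \<le> 2 * G z * norm (s - a)"
          using norm_triangle_ineq4[of "f z s - f z a" "f' z a (s - a)"] by (simp add: algebra_simps)
        then show "norm (?R z s) / norm (s - a) \<le> 2 * G z" using s by (simp add: divide_le_eq)
      qed
    qed
  qed (use G e in auto)
  define \<delta> where "\<delta> = min d r"
  have modulus: "AE z in F. \<forall>s\<in>ball a \<delta>. norm (?R z s) \<le> w z * norm (s - a)"
    using dw(5) AE_space
  proof eventually_elim
    case (elim z)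
    show ?case
    proof
      fix s assume s: "s \<in> ball a \<delta>"
      show "norm (?R z s) \<le> w z * norm (s - a)"
      proof (cases "s = a")
        case True
        then show ?thesis using lin[OF elim(2)] by (simp add: linear_simps)
      next
        case False
        then have "norm (?R z s) / norm (s - a) \<le> w z"
          using elim(1) s by (auto simp: \<delta>_def dist_commute)
        then show ?thesis using False by (simp add: divide_le_eq)
      qed
    qed
  qed
  have close: "eventually (\<lambda>(n, \<omega>). \<forall>h. norm (sample_mean n (\<lambda>z. f' z a h) \<omega> - (LINT z|F. f' z a h))
      \<le> e / 2 * norm h) (high_prob M)"
    by (rule eventually_linear_mean_close) (use lin int e in \<open>auto intro: bounded_linear.linear\<close>)
  show thesis
  proof (rule that)
    show "\<delta> > 0" using dw(1) r by (simp add: \<delta>_def)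
    show "eventually (\<lambda>(n, \<omega>). \<forall>s\<in>ball a \<delta>.
      norm (sample_mean n (\<lambda>z. f z s) \<omega> - sample_mean n (\<lambda>z. f z a) \<omega> - (LINT z|F. f' z a (s - a)))
        \<le> e * norm (s - a)) (high_prob M)"
      using eventually_sample_mean_less[OF dw(2,4)] eventually_obs[OF modulus]
        close
    proof eventually_elim
      case (elim x)
      obtain n \<omega> where x: "x = (n, \<omega>)" by (cases x)
      have "norm (sample_mean n (\<lambda>z. f z s) \<omega> - sample_mean n (\<lambda>z. f z a) \<omega> - (LINT z|F. f' z a (s - a)))
        \<le> e * norm (s - a)" if s: "s \<in> ball a \<delta>" for s
      proof -
        have "norm (sample_mean n (\<lambda>z. ?R z s) \<omega>) \<le> sample_mean n (\<lambda>z. norm (?R z s)) \<omega>"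
          by (rule norm_sample_mean_le)
        also have "\<dots> \<le> sample_mean n (\<lambda>z. w z * norm (s - a)) \<omega>" using elim s x by (intro sample_mean_mono) auto
        also have "\<dots> = sample_mean n w \<omega> * norm (s - a)" by (simp add: sample_mean_def sum_distrib_right)
        also have "\<dots> \<le> e / 2 * norm (s - a)" using elim x by (intro mult_right_mono) auto
        finally have 1: "norm (sample_mean n (\<lambda>z. ?R z s) \<omega>) \<le> e / 2 * norm (s - a)" .
        have 2: "norm (sample_mean n (\<lambda>z. f' z a (s - a)) \<omega> - (LINT z|F. f' z a (s - a))) \<le> e / 2 * norm (s - a)"
          using elim x by auto
        have "sample_mean n (\<lambda>z. f z s) \<omega> - sample_mean n (\<lambda>z. f z a) \<omega> - (LINT z|F. f' z a (s - a)) =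
          sample_mean n (\<lambda>z. ?R z s) \<omega> + (sample_mean n (\<lambda>z. f' z a (s - a)) \<omega> - (LINT z|F. f' z a (s - a)))"
          by (simp add: sample_mean_diff)
        then show ?thesis
          using norm_triangle_mono[OF 1 2] by (simp add: field_simps)
      qed
      then show ?case by (simp add: x)
    qed
  qed
qed

end

section \<open>Contamination and influence curves\<close>

lemma nn_integral_add_measure:
  assumes Q: "sets Q = sets P" and f: "f \<in> borel_measurable P"
  shows "nn_integral (add_measure P Q) f = nn_integral P f + nn_integral Q f"
proof -
  have sp: "space Q = space P" using Q by (rule sets_eq_imp_space_eq)
  have meas: "borel_measurable Q = (borel_measurable P :: ('a \<Rightarrow> ennreal) set)"
    "borel_measurable (add_measure P Q) = (borel_measurable P :: ('a \<Rightarrow> ennreal) set)"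
    by (intro measurable_cong_sets Q refl sets_add_measure)+
  from f show ?thesis
  proof induction
    case (cong f g)
    have eqs: "nn_integral (add_measure P Q) f = nn_integral (add_measure P Q) g"
      "nn_integral P f = nn_integral P g" "nn_integral Q f = nn_integral Q g"
      by (auto intro!: nn_integral_cong simp: sp cong.hyps)
    show ?case unfolding eqs by (rule cong.IH)
  next
    case (set A)
    then show ?case using Q by (simp add: emeasure_add_measure)
  next
    case (mult f c)
    then show ?case by (simp add: nn_integral_cmult meas distrib_left)
  next
    case (add f g)
    then show ?case by (simp add: nn_integral_add meas ac_simps)
  next
    case (seq U)
    have Sup: "(SUP i. U i) = (\<lambda>z. SUP i. U i z)" by (auto simp: fun_eq_iff image_comp)
    have "nn_integral (add_measure P Q) (SUP i. U i) = (SUP i. nn_integral P (U i) + nn_integral Q (U i))"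
      unfolding Sup using seq by (subst nn_integral_monotone_convergence_SUP) (auto simp: meas)
    also have "\<dots> = (SUP i. nn_integral P (U i)) + (SUP i. nn_integral Q (U i))"
      using seq by (intro ennreal_SUP_add) (auto simp: incseq_def le_fun_def intro!: nn_integral_mono)
    also have "\<dots> = nn_integral P (SUP i. U i) + nn_integral Q (SUP i. U i)"
      unfolding Sup using seq by (simp add: nn_integral_monotone_convergence_SUP meas)
    finally show ?case .
  qed
qed

text \<open>Integrability reduces to the extended integral of the norm; the value of the integral is passed from
  simple functions to the limit by dominated convergence for each of the three measures.\<close>

lemma
  fixes f :: "'z \<Rightarrow> 'b::{banach, second_countable_topology}"
  assumes Q: "sets Q = sets P"
  shows integrable_add_measure: "integrable (add_measure P Q) f \<longleftrightarrow> integrable P f \<and> integrable Q f" (is "?A f \<longleftrightarrow> ?PQ f")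
    and integral_add_measure: "integrable P f \<Longrightarrow> integrable Q f \<Longrightarrow>
      integral\<^sup>L (add_measure P Q) f = integral\<^sup>L P f + integral\<^sup>L Q f"
proof -
  have sp: "space Q = space P" using Q by (rule sets_eq_imp_space_eq)
  have meas: "borel_measurable Q = (borel_measurable P :: ('z \<Rightarrow> 'b) set)"
    "borel_measurable (add_measure P Q) = (borel_measurable P :: ('z \<Rightarrow> 'b) set)"
    by (intro measurable_cong_sets Q refl sets_add_measure)+
  have int: "?A f \<longleftrightarrow> ?PQ f" for f :: "'z \<Rightarrow> 'b"
    using nn_integral_add_measure[OF Q, of "\<lambda>z. norm (f z)"]
    by (auto simp: integrable_iff_bounded meas)
  then show "?A f \<longleftrightarrow> ?PQ f" .
  assume "integrable P f" "integrable Q f"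
  then have "?A f" by (simp add: int)
  then show "integral\<^sup>L (add_measure P Q) f = integral\<^sup>L P f + integral\<^sup>L Q f"
  proof (induction f rule: integrable_induct)
    case (base A c)
    then have A: "A \<in> sets P" "A \<in> sets Q" "emeasure P A < \<infinity>" "emeasure Q A < \<infinity>"
      using Q by (auto simp: emeasure_add_measure less_top[symmetric])
    then have "measure (add_measure P Q) A = measure P A + measure Q A"
      using Q by (simp add: measure_def emeasure_add_measure enn2real_plus)
    then show ?case using A base
      by (simp add: scaleR_add_left)
  next
    case (add f g)
    then show ?case by (simp add: int)
  next
    case (lim f s)
    have intf: "integrable P f" "integrable Q f" using lim.hyps(4) by (auto simp: int)
    have ints: "s i \<in> borel_measurable P" "s i \<in> borel_measurable Q" for i
      using lim.hyps(1)[of i] unfolding int by auto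
    have "integrable (add_measure P Q) f" using intf by (simp add: int)
    then have bound: "integrable P (\<lambda>z. 2 * norm (f z))" "integrable Q (\<lambda>z. 2 * norm (f z))"
      "integrable (add_measure P Q) (\<lambda>z. 2 * norm (f z))"
      using intf by auto
    have "(\<lambda>i. integral\<^sup>L (add_measure P Q) (s i)) \<longlonglongrightarrow> integral\<^sup>L (add_measure P Q) f"
      by (rule integral_dominated_convergence[OF _ _ bound(3)]) (use lim.hyps in auto)
    moreover have "(\<lambda>i. integral\<^sup>L P (s i) + integral\<^sup>L Q (s i)) \<longlonglongrightarrow> integral\<^sup>L P f + integral\<^sup>L Q f"
      by (intro tendsto_add integral_dominated_convergence[OF _ _ bound(1)] integral_dominated_convergence[OF _ _ bound(2)])
        (use lim.hyps(2,3) intf ints sp in auto)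
    ultimately show ?case using lim.IH by (simp add: LIMSEQ_unique)
  qed
qed

lemma scale_measure_eq_density:
  "scale_measure r M = density M (\<lambda>_. r)"
  by (rule measure_eqI) (auto simp: emeasure_density_const)

lemma
  fixes f :: "'z \<Rightarrow> 'b::{banach, second_countable_topology}"
  assumes t: "0 \<le> t" "t \<le> 1" and x: "x \<in> space P" and f: "integrable P f"
  shows integrable_contaminate: "integrable (contaminate t P x) f"
    and integral_contaminate: "integral\<^sup>L (contaminate t P x) f = (1 - t) *\<^sub>R integral\<^sup>L P f + t *\<^sub>R f x"
proof -
  have [measurable]: "f \<in> borel_measurable P" using f by auto
  have ret: "integrable (return P x) f" "integral\<^sup>L (return P x) f = f x"
    using x by (auto simp: integrable_iff_bounded nn_integral_return integral_return)
  have scale: "integrable (scale_measure (ennreal r) M) f" 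
    "integral\<^sup>L (scale_measure (ennreal r) M) f = r *\<^sub>R integral\<^sup>L M f"
    if "0 \<le> r" "integrable M f" for r and M :: "'z measure"
    using that unfolding scale_measure_eq_density by (simp_all add: integrable_density integral_density)
  show "integrable (contaminate t P x) f"
    using t f ret scale by (simp add: contaminate_def integrable_add_measure)
  show "integral\<^sup>L (contaminate t P x) f = (1 - t) *\<^sub>R integral\<^sup>L P f + t *\<^sub>R f x"
    using t f ret scale by (simp add: contaminate_def integral_add_measure)
qed

lemma mspace_C_space:
  assumes "compact \<Theta>"
  shows "mspace (C_space \<Theta>) = {f \<in> extensional \<Theta>. continuous_on \<Theta> f}"
  using assms unfolding C_space_def
  by (subst compactin_mspace_cfunspace) (auto simp: compactin_subtopology)

text \<open>Neighbourhoods in the function space in terms of pointwise distances. The radius is halved because a strict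
  pointwise bound gives only a weak bound for the supremum.\<close>

lemma C_space_neighbourhood:
  assumes U: "openin (mtopology_of (C_space \<Theta>)) U" "\<eta> \<in> U"
  obtains e where "e > 0"
    "\<And>f. f \<in> mspace (C_space \<Theta>) \<Longrightarrow> (\<And>\<theta>. \<theta> \<in> \<Theta> \<Longrightarrow> dist (f \<theta>) (\<eta> \<theta>) < e) \<Longrightarrow> f \<in> U"
proof -
  interpret Metric_space "mspace (C_space \<Theta>)" "mdist (C_space \<Theta>)" by (rule Metric_space_mspace_mdist)
  obtain r where r: "r > 0" "mball \<eta> r \<subseteq> U" and sub: "U \<subseteq> mspace (C_space \<Theta>)"
    using U unfolding mtopology_of_def openin_mtopology by blast
  show thesis
  proof (rule that[of "r / 2"])
    show "r / 2 > 0" using r by simp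
    fix f assume f: "f \<in> mspace (C_space \<Theta>)" "\<And>\<theta>. \<theta> \<in> \<Theta> \<Longrightarrow> dist (f \<theta>) (\<eta> \<theta>) < r / 2"
    have "mdist (C_space \<Theta>) \<eta> f \<le> r / 2"
      unfolding C_space_def using r f(2) by (intro mdist_cfunspace_le) (auto simp: dist_commute less_imp_le)
    then have "f \<in> mball \<eta> r" using r f(1) U sub by auto
    then show "f \<in> U" using r by blast
  qed
qed

text \<open>The functional \<open>Q \<mapsto> eta_reg \<Theta> \<phi> J' Q\<close> is affine in the measure, so contamination of \<open>F\<close> at \<open>x\<close> moves
  \<open>\<eta>\<close> along the straight line with direction \<open>h = \<phi> x + J' - \<eta>\<close>. The influence curve is therefore the directional
  derivative of \<open>T\<close> at \<open>\<eta>\<close>, given by Hadamard differentiability along the compact set \<open>{h}\<close>, and \<open>\<eta> \<theta>\<^sub>0 = 0\<close>.\<close>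

lemma influence_curve_M_functional:
  assumes F: "prob_space F" and comp: "compact \<Theta>"
    and int: "\<And>\<theta>. \<theta> \<in> \<Theta> \<Longrightarrow> integrable F (\<lambda>z. \<phi> z \<theta>)"
    and cont: "\<And>z. z \<in> space F \<Longrightarrow> continuous_on \<Theta> (\<lambda>\<theta>. \<phi> z \<theta> + J' \<theta>)"
    and MF: "M_functional \<Theta> (eta_reg \<Theta> \<phi> J' F) \<theta>\<^sub>0 d\<eta> V T"
  shows "influence_curve (stat_domain \<Theta> \<phi> J' V) (\<lambda>Q. T (eta_reg \<Theta> \<phi> J' Q)) F
    (\<lambda>z. - inv d\<eta> (\<phi> z \<theta>\<^sub>0 + J' \<theta>\<^sub>0))"
proof -
  define \<eta> where "\<eta> = eta_reg \<Theta> \<phi> J' F"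
  note MF = MF[folded \<eta>_def, unfolded M_functional_def]
  obtain U where U: "openin (mtopology_of (C_space \<Theta>)) U" "\<eta> \<in> U" "U \<subseteq> V" using MF by blast
  obtain e where e: "e > 0"
    "\<And>f. f \<in> mspace (C_space \<Theta>) \<Longrightarrow> (\<And>\<theta>. \<theta> \<in> \<Theta> \<Longrightarrow> dist (f \<theta>) (\<eta> \<theta>) < e) \<Longrightarrow> f \<in> U"
    by (rule C_space_neighbourhood[OF U(1,2)]) blast
  have \<eta>V: "\<eta> \<in> V" using U by blast
  have \<theta>\<^sub>0: "\<theta>\<^sub>0 \<in> \<Theta>" "\<eta> \<theta>\<^sub>0 = 0" using MF \<eta>V by auto
  have \<eta>C: "continuous_on \<Theta> \<eta>" using MF \<eta>V mspace_C_space[OF comp] by auto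
  have "F \<in> stat_domain \<Theta> \<phi> J' V" using int \<eta>V by (simp add: stat_domain_def \<eta>_def)
  moreover have "(\<forall>\<^sub>F t in at_right 0. contaminate t F x \<in> stat_domain \<Theta> \<phi> J' V) \<and>
        ((\<lambda>t. (T (eta_reg \<Theta> \<phi> J' (contaminate t F x)) - T \<eta>) /\<^sub>R t)
          \<longlongrightarrow> - inv d\<eta> (\<phi> x \<theta>\<^sub>0 + J' \<theta>\<^sub>0)) (at_right 0)" if x: "x \<in> space F" for x
  proof -
    define h where "h = restrict (\<lambda>\<theta>. \<phi> x \<theta> + J' \<theta> - \<eta> \<theta>) \<Theta>"
    have hc: "continuous_on \<Theta> h"
      using continuous_on_diff[OF cont[OF x] \<eta>C] by (auto simp: h_def cong: continuous_on_cong)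
    then have hC: "h \<in> mspace (C_space \<Theta>)" using mspace_C_space[OF comp] by (auto simp: h_def)
    obtain B where B: "B > 0" "\<And>\<theta>. \<theta> \<in> \<Theta> \<Longrightarrow> norm (h \<theta>) \<le> B"
      using compact_imp_bounded[OF compact_continuous_image[OF hc comp]] by (auto simp: bounded_pos)
    have path: "eta_reg \<Theta> \<phi> J' (contaminate t F x) = C_comb \<Theta> \<eta> t h" if t: "0 \<le> t" "t \<le> 1" for t
      unfolding eta_reg_def C_comb_def
    proof (rule restrict_ext)
      fix \<theta> assume \<theta>: "\<theta> \<in> \<Theta>"
      show "(LINT z|contaminate t F x. \<phi> z \<theta>) + J' \<theta> = \<eta> \<theta> + t *\<^sub>R h \<theta>"
        using \<theta> integral_contaminate[OF t x int[OF \<theta>]]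
        by (simp add: h_def \<eta>_def eta_reg_def algebra_simps)
    qed
    have small: "\<forall>\<^sub>F t::real in at_right 0. 0 < t \<and> t < min 1 (e / B)"
      using e B by (intro eventually_at_rightI[of 0 "min 1 (e / B)"]) auto
    have "\<forall>\<^sub>F t in at_right 0. contaminate t F x \<in> stat_domain \<Theta> \<phi> J' V"
      using small
    proof eventually_elim
      fix t :: real assume t: "0 < t \<and> t < min 1 (e / B)"
      have "C_comb \<Theta> \<eta> t h \<in> U"
      proof (rule e(2))
        have "continuous_on \<Theta> (\<lambda>\<theta>. \<eta> \<theta> + t *\<^sub>R h \<theta>)" by (intro continuous_intros \<eta>C hc)
        then show "C_comb \<Theta> \<eta> t h \<in> mspace (C_space \<Theta>)"
          using mspace_C_space[OF comp] by (auto simp: C_comb_def cong: continuous_on_cong)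
        fix \<theta> assume \<theta>: "\<theta> \<in> \<Theta>"
        have "t * norm (h \<theta>) \<le> t * B" using t B(2)[OF \<theta>] by (intro mult_left_mono) auto
        also have "\<dots> < e" using t B(1) by (simp add: pos_less_divide_eq)
        finally show "dist (C_comb \<Theta> \<eta> t h \<theta>) (\<eta> \<theta>) < e" using \<theta> t by (simp add: C_comb_def dist_norm)
      qed
      then show "contaminate t F x \<in> stat_domain \<Theta> \<phi> J' V"
        using U(3) t path[of t] integrable_contaminate[OF _ _ x int, of t] by (auto simp: stat_domain_def)
    qed
    moreover have "((\<lambda>t. (T (eta_reg \<Theta> \<phi> J' (contaminate t F x)) - T \<eta>) /\<^sub>R t)
          \<longlongrightarrow> - inv d\<eta> (\<phi> x \<theta>\<^sub>0 + J' \<theta>\<^sub>0)) (at_right 0)"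
    proof -
      let ?D = "- inv d\<eta> (h \<theta>\<^sub>0)"
      have "compactin (mtopology_of (C_space \<Theta>)) {h}" using hC by simp
      then have "uniform_limit {h} (\<lambda>t h. norm (T (C_comb \<Theta> \<eta> t h) - T \<eta> - t *\<^sub>R - inv d\<eta> (h \<theta>\<^sub>0)) / t)
          (\<lambda>_. 0) (at 0)"
        using MF unfolding hadamard_derivative_at_def by blast
      then have "((\<lambda>t. norm (T (C_comb \<Theta> \<eta> t h) - T \<eta> - t *\<^sub>R ?D) / t) \<longlongrightarrow> 0) (at 0)"
        by simp
      then have "((\<lambda>t. norm (T (C_comb \<Theta> \<eta> t h) - T \<eta> - t *\<^sub>R ?D) / t) \<longlongrightarrow> 0) (at_right 0)"
        by (rule tendsto_within_subset) simp
      then have "((\<lambda>t. norm ((T (eta_reg \<Theta> \<phi> J' (contaminate t F x)) - T \<eta>) /\<^sub>R t - ?D)) \<longlongrightarrow> 0) (at_right 0)"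
      proof (rule Lim_transform_eventually)
        show "\<forall>\<^sub>F t in at_right 0. norm (T (C_comb \<Theta> \<eta> t h) - T \<eta> - t *\<^sub>R ?D) / t =
            norm ((T (eta_reg \<Theta> \<phi> J' (contaminate t F x)) - T \<eta>) /\<^sub>R t - ?D)"
          using small
        proof eventually_elim
          fix t :: real assume t: "0 < t \<and> t < min 1 (e / B)"
          let ?N = "T (C_comb \<Theta> \<eta> t h) - T \<eta>"
          have "?N /\<^sub>R t - ?D = (?N - t *\<^sub>R ?D) /\<^sub>R t" using t by (simp add: scaleR_diff_right scaleR_add_right)
          then show "norm (?N - t *\<^sub>R ?D) / t = norm ((T (eta_reg \<Theta> \<phi> J' (contaminate t F x)) - T \<eta>) /\<^sub>R t - ?D)"
            using t path[of t] by (simp add: divide_inverse_commute)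
        qed
      qed
      then have "((\<lambda>t. (T (eta_reg \<Theta> \<phi> J' (contaminate t F x)) - T \<eta>) /\<^sub>R t) \<longlongrightarrow> ?D) (at_right 0)"
        unfolding tendsto_norm_zero_iff by (rule LIM_zero_cancel)
      then show ?thesis using \<theta>\<^sub>0 by (simp add: h_def)
    qed
    ultimately show ?thesis by blast
  qed
  ultimately show ?thesis unfolding influence_curve_def \<eta>_def by blast
qed

section \<open>Asymptotic linearity of regularized M-estimators\<close>

theorem theorem3p3:
  fixes \<X> :: "(real^'p) set" and \<Y> :: "real set" and \<Theta> :: "(real^'p) set"
    and P :: "real^'p \<Rightarrow> ((real^'p) \<times> real) measure"
    and \<Lambda> :: "real^'p \<Rightarrow> (real^'p) \<times> real \<Rightarrow> real^'p"
    and loss :: "(real^'p) \<times> real \<Rightarrow> (real^'p \<Rightarrow> real) \<Rightarrow> real"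
    and L :: "(real^'p) \<times> real \<Rightarrow> real^'p \<Rightarrow> real"
    and \<phi> \<phi>\<^sub>J :: "(real^'p) \<times> real \<Rightarrow> real^'p \<Rightarrow> real^'p"
    and d\<phi>\<^sub>J :: "(real^'p) \<times> real \<Rightarrow> real^'p \<Rightarrow> real^'p \<Rightarrow> real^'p"
    and J :: "real^'p \<Rightarrow> real" and J' :: "real^'p \<Rightarrow> real^'p"
    and \<theta>\<^sub>0 :: "real^'p" and \<eta> d\<eta> :: "real^'p \<Rightarrow> real^'p"
    and V :: "(real^'p \<Rightarrow> real^'p) set" and T :: "(real^'p \<Rightarrow> real^'p) \<Rightarrow> real^'p"
    and M :: "'w measure" and obs :: "nat \<Rightarrow> 'w \<Rightarrow> (real^'p) \<times> real"
    and Z :: "nat \<Rightarrow> 'w \<Rightarrow> real^'p \<Rightarrow> real^'p" and S :: "nat \<Rightarrow> 'w \<Rightarrow> real^'p"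
  assumes model: "linear_regression_model \<X> \<Y> \<Theta> P"
    \<comment> \<open>i.i.d. observations with distribution \<open>P \<theta>\<^sub>0\<close>\<close>
    and "prob_space M"
    and "prob_space.indep_vars M (\<lambda>_. P \<theta>\<^sub>0) obs UNIV"
    and "\<And>i. distr M (P \<theta>\<^sub>0) (obs i) = P \<theta>\<^sub>0"
    \<comment> \<open>loss, penalty and their derivatives\<close>
    and "\<And>z \<theta>. L z \<theta> = loss z (lin_reg \<theta>)"
    and "\<And>z \<theta>. z \<in> \<X> \<times> \<Y> \<Longrightarrow> \<theta> \<in> \<Theta> \<Longrightarrow> 0 \<le> L z \<theta>"
    and "\<And>z \<theta>. z \<in> \<X> \<times> \<Y> \<Longrightarrow> \<theta> \<in> \<Theta> \<Longrightarrow>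
           (L z has_derivative (\<lambda>h. \<phi> z \<theta> \<bullet> h)) (at \<theta> within \<Theta>)"
    and "\<And>\<theta>. \<theta> \<in> \<Theta> \<Longrightarrow> (J has_derivative (\<lambda>h. J' \<theta> \<bullet> h)) (at \<theta> within \<Theta>)"
    and "\<And>z \<theta>. \<phi>\<^sub>J z \<theta> = \<phi> z \<theta> + J' \<theta>"
    and "\<And>z \<theta>. z \<in> \<X> \<times> \<Y> \<Longrightarrow> \<theta> \<in> \<Theta> \<Longrightarrow>
           (\<phi>\<^sub>J z has_derivative d\<phi>\<^sub>J z \<theta>) (at \<theta> within \<Theta>)"
    \<comment> \<open>integration and differentiation are interchangeable\<close>
    and "diff_under_integral (P \<theta>\<^sub>0) \<Theta> L (\<lambda>z \<theta> h. \<phi> z \<theta> \<bullet> h)"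
    and "diff_under_integral (P \<theta>\<^sub>0) \<Theta> \<phi>\<^sub>J d\<phi>\<^sub>J"
    and "\<eta> = eta_reg \<Theta> \<phi> J' (P \<theta>\<^sub>0)"
    and "Z = Z_reg \<Theta> \<phi> J' obs"
    and "M_functional \<Theta> \<eta> \<theta>\<^sub>0 d\<eta> V T"
    and "\<And>n \<omega>. S n \<omega> = T (Z n \<omega>)"
    \<comment> \<open>(i)\<close>
    and "\<And>\<theta>. \<theta> \<in> \<Theta> \<Longrightarrow> L2_differentiable_at P \<Theta> \<theta> (\<Lambda> \<theta>)"
    and "\<And>\<theta> \<psi>. \<theta> \<in> \<Theta> \<Longrightarrow>
           influence_curve (stat_domain \<Theta> \<phi> J' V) (\<lambda>Q. T (eta_reg \<Theta> \<phi> J' Q)) (P \<theta>) \<psi> \<Longrightarrow>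
           \<psi> \<in> Psi2 (P \<theta>) (\<Lambda> \<theta>)"
    \<comment> \<open>(ii)\<close>
    and "\<Theta> \<noteq> {}" and "compact \<Theta>" and "\<Theta> = closure (interior \<Theta>)"
    \<comment> \<open>(iii)\<close>
    and "\<And>\<theta>. \<theta> \<in> \<Theta> \<Longrightarrow> (\<lambda>z. \<phi>\<^sub>J z \<theta>) \<in> L2_space (P \<theta>\<^sub>0)"
    \<comment> \<open>(iv)\<close>
    and "\<theta>\<^sub>0 \<in> interior \<Theta>" and "\<eta> \<theta>\<^sub>0 = 0"
    and "locally_homeomorphic_at \<Theta> \<eta> \<theta>\<^sub>0"
    and "(\<eta> has_derivative d\<eta>) (at \<theta>\<^sub>0)" and "bounded_linear d\<eta>" and "bij d\<eta>"
    \<comment> \<open>(v)\<close>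
    and "\<And>\<theta>. \<theta> \<in> \<Theta> \<Longrightarrow> 0 \<le> J \<theta>" and "J 0 = 0"
    and "\<And>x y u v. x \<in> \<Theta> \<Longrightarrow> y \<in> \<Theta> \<Longrightarrow> 0 \<le> u \<Longrightarrow> 0 \<le> v \<Longrightarrow> u + v = 1 \<Longrightarrow>
           u *\<^sub>R x + v *\<^sub>R y \<in> \<Theta> \<Longrightarrow> J (u *\<^sub>R x + v *\<^sub>R y) \<le> u * J x + v * J y"
    \<comment> \<open>(vi)\<close>
    and "root_n_consistent M S \<theta>\<^sub>0"
    \<comment> \<open>(vii)\<close>
    and "\<And>n \<omega>. n \<ge> 1 \<Longrightarrow> \<omega> \<in> space M \<Longrightarrow> twice_differentiable_on (Z n \<omega>) \<Theta>"
  shows "asymptotically_linear M obs (P \<theta>\<^sub>0) (\<Lambda> \<theta>\<^sub>0) S \<theta>\<^sub>0"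
proof -
  note der_\<phi>\<^sub>J = assms(10) and \<eta>_eq = assms(13) and Z_eq = assms(14) and M_fun = assms(15)
    and S_eq = assms(16) and influence = assms(18) and inner = assms(23) and root_n = assms(32)
  define F where "F = P \<theta>\<^sub>0"
  have \<theta>\<^sub>0: "\<theta>\<^sub>0 \<in> \<Theta>" using inner interior_subset by blast
  have F: "prob_space F" "sets F = sets (restrict_space borel (\<X> \<times> \<Y>))"
    using model \<theta>\<^sub>0 by (auto simp: linear_regression_model_def F_def)
  have space_F: "space F = \<X> \<times> \<Y>" using sets_eq_imp_space_eq[OF F(2)] by (simp add: space_restrict_space)
  interpret F: prob_space F by (rule F(1))
  interpret M: prob_space M by fact
  interpret iid_sample M F obs
    using assms(3,4) by unfold_locales (auto simp: F_def)
  have \<phi>\<^sub>J: "\<phi>\<^sub>J z \<theta> = \<phi> z \<theta> + J' \<theta>" for z \<theta> by fact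
  have der: "(\<phi>\<^sub>J z has_derivative d\<phi>\<^sub>J z \<theta>) (at \<theta> within \<Theta>)" if "z \<in> space F" "\<theta> \<in> \<Theta>" for z \<theta>
    using der_\<phi>\<^sub>J that by (simp add: space_F)
  have comp: "compact \<Theta>" by fact
  have MF: "M_functional \<Theta> (eta_reg \<Theta> \<phi> J' F) \<theta>\<^sub>0 d\<eta> V T"
    using M_fun by (simp add: \<eta>_eq F_def)
  note dL = \<open>diff_under_integral (P \<theta>\<^sub>0) \<Theta> L (\<lambda>z \<theta> h. \<phi> z \<theta> \<bullet> h)\<close>[folded F_def, unfolded diff_under_integral_def, rule_format]
  note d\<phi> = \<open>diff_under_integral (P \<theta>\<^sub>0) \<Theta> \<phi>\<^sub>J d\<phi>\<^sub>J\<close>[folded F_def, unfolded diff_under_integral_def, rule_format]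
  have int\<^sub>J: "integrable F (\<lambda>z. \<phi>\<^sub>J z \<theta>)" if "\<theta> \<in> \<Theta>" for \<theta> using d\<phi>[OF that] by blast
  have int: "integrable F (\<lambda>z. \<phi> z \<theta>)" if "\<theta> \<in> \<Theta>" for \<theta>
    using Bochner_Integration.integrable_diff[OF int\<^sub>J[OF that], of "\<lambda>_. J' \<theta>"] by (simp add: \<phi>\<^sub>J)
  have cont\<^sub>J: "continuous_on \<Theta> (\<phi>\<^sub>J z)" if "z \<in> space F" for z
    using der[OF that] by (rule has_derivative_continuous_on)
  have \<eta>: "\<eta> \<theta> = (LINT z|F. \<phi>\<^sub>J z \<theta>)" if "\<theta> \<in> \<Theta>" for \<theta>
    using that int[OF that] by (simp add: \<eta>_eq eta_reg_def \<phi>\<^sub>J F.prob_space flip: F_def)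
  have Z: "Z n \<omega> \<theta> = sample_mean n (\<lambda>z. \<phi>\<^sub>J z \<theta>) \<omega>" if "n \<noteq> 0" "\<theta> \<in> \<Theta>" for n \<omega> \<theta>
    using that by (simp add: Z_eq Z_reg_def sample_mean_def \<phi>\<^sub>J sum.distrib scaleR_add_right sum_constant_scaleR del: sum_constant)

  define \<psi> where "\<psi> z = - inv d\<eta> (\<phi>\<^sub>J z \<theta>\<^sub>0)" for z
  have "influence_curve (stat_domain \<Theta> \<phi> J' V) (\<lambda>Q. T (eta_reg \<Theta> \<phi> J' Q)) F \<psi>"
    unfolding \<psi>_def[abs_def] \<phi>\<^sub>J using cont\<^sub>J
    by (intro influence_curve_M_functional F comp int MF) (auto simp: \<phi>\<^sub>J[abs_def])
  then have Psi2: "\<psi> \<in> Psi2 (P \<theta>\<^sub>0) (\<Lambda> \<theta>\<^sub>0)"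
    using influence \<theta>\<^sub>0 by (simp add: F_def)

  \<comment> \<open>Since \<open>\<phi>\<close> is the derivative of \<open>L\<close>, the majorant for differentiation of
    \<open>L\<close> bounds \<open>\<phi>\<close> itself; put \<open>h = \<phi> z \<theta>\<close>. A bound on the derivative of
    \<open>\<phi>\<close> would not suffice here, as nearby points of \<open>\<Theta>\<close> need not be joined by short paths in
    \<open>\<Theta>\<close>.\<close>
  have dom\<^sub>L: "\<exists>U G. open U \<and> a \<in> U \<and> integrable F G \<and> (AE z in F. \<forall>\<theta>\<in>U \<inter> \<Theta>. norm (\<phi> z \<theta>) \<le> G z)"
    if a: "a \<in> \<Theta>" for a
  proof -
    obtain U G where U: "open U" "a \<in> U" "integrable F G"
      "AE z in F. \<forall>\<theta>\<in>U \<inter> \<Theta>. \<forall>h. norm (\<phi> z \<theta> \<bullet> h) \<le> G z * norm h"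
      using dL[OF a] by blast
    from U(4) have "AE z in F. \<forall>\<theta>\<in>U \<inter> \<Theta>. norm (\<phi> z \<theta>) \<le> \<bar>G z\<bar>"
    proof eventually_elim
      case (elim z)
      show ?case
      proof
        fix \<theta> assume "\<theta> \<in> U \<inter> \<Theta>"
        then have "norm (\<phi> z \<theta>) * norm (\<phi> z \<theta>) \<le> G z * norm (\<phi> z \<theta>)"
          using elim[rule_format, of \<theta> "\<phi> z \<theta>"] by (simp add: dot_square_norm power2_eq_square)
        then show "norm (\<phi> z \<theta>) \<le> \<bar>G z\<bar>" by (cases "\<phi> z \<theta> = 0") auto
      qed
    qed
    then show ?thesis using U(1-3) by (intro exI[of _ U] exI[of _ "\<lambda>z. \<bar>G z\<bar>"]) auto
  qed
  \<comment> \<open>The penalty gradient \<open>J'\<close> does not depend on \<open>z\<close>. As the difference of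
    \<open>\<phi>\<^sub>J\<close> and \<open>\<phi>\<close> at one suitable data point \<open>z\<^sub>0\<close>, it is bounded
    near \<open>a\<close>.\<close>
  have dom\<^sub>J: "\<exists>U G. open U \<and> a \<in> U \<and> integrable F G \<and> (AE z in F. \<forall>\<theta>\<in>U \<inter> \<Theta>. norm (\<phi>\<^sub>J z \<theta>) \<le> G z)"
    if a: "a \<in> \<Theta>" for a
  proof -
    obtain U G where U: "open U" "a \<in> U" "integrable F G" "AE z in F. \<forall>\<theta>\<in>U \<inter> \<Theta>. norm (\<phi> z \<theta>) \<le> G z"
      using dom\<^sub>L[OF a] by blast
    have "\<exists>z\<in>space F. \<forall>\<theta>\<in>U \<inter> \<Theta>. norm (\<phi> z \<theta>) \<le> G z"
    proof (rule ccontr)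
      assume "\<not> ?thesis"
      then have none: "\<And>z. z \<in> space F \<Longrightarrow> \<not> (\<forall>\<theta>\<in>U \<inter> \<Theta>. norm (\<phi> z \<theta>) \<le> G z)" by blast
      have "AE z in F. False" using U(4) AE_space by eventually_elim (use none in blast)
      then show False by simp
    qed
    then obtain z\<^sub>0 where z\<^sub>0: "z\<^sub>0 \<in> space F" "\<forall>\<theta>\<in>U \<inter> \<Theta>. norm (\<phi> z\<^sub>0 \<theta>) \<le> G z\<^sub>0" by blast
    obtain B where B: "\<And>\<theta>. \<theta> \<in> \<Theta> \<Longrightarrow> norm (\<phi>\<^sub>J z\<^sub>0 \<theta>) \<le> B"
      using compact_imp_bounded[OF compact_continuous_image[OF cont\<^sub>J[OF z\<^sub>0(1)] comp]] by (auto simp: bounded_iff)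
    have J': "norm (J' \<theta>) \<le> B + G z\<^sub>0" if "\<theta> \<in> U \<inter> \<Theta>" for \<theta>
    proof -
      have "norm (J' \<theta>) \<le> norm (\<phi>\<^sub>J z\<^sub>0 \<theta>) + norm (\<phi> z\<^sub>0 \<theta>)"
        using norm_triangle_ineq4[of "\<phi>\<^sub>J z\<^sub>0 \<theta>" "\<phi> z\<^sub>0 \<theta>"] by (simp add: \<phi>\<^sub>J)
      also have "\<dots> \<le> B + G z\<^sub>0" using that B z\<^sub>0(2) by (intro add_mono) auto
      finally show ?thesis .
    qed
    from U(4) have "AE z in F. \<forall>\<theta>\<in>U \<inter> \<Theta>. norm (\<phi>\<^sub>J z \<theta>) \<le> G z + (B + G z\<^sub>0)"
      by eventually_elim (auto simp: \<phi>\<^sub>J intro!: norm_triangle_mono J')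
    then show ?thesis using U(1-3) by (intro exI[of _ U] exI[of _ "\<lambda>z. G z + (B + G z\<^sub>0)"]) auto
  qed

  \<comment> \<open>Uniform convergence carries \<open>Z\<^sub>n\<close> into the neighbourhood \<open>V\<close>, where
    \<open>T\<close> picks a zero.\<close>
  obtain W where W: "openin (mtopology_of (C_space \<Theta>)) W" "\<eta> \<in> W" "W \<subseteq> V"
    using M_fun unfolding M_functional_def by blast
  obtain \<epsilon> where \<epsilon>: "\<epsilon> > 0"
    "\<And>f. f \<in> mspace (C_space \<Theta>) \<Longrightarrow> (\<And>\<theta>. \<theta> \<in> \<Theta> \<Longrightarrow> dist (f \<theta>) (\<eta> \<theta>) < \<epsilon>) \<Longrightarrow> f \<in> W"
    by (rule C_space_neighbourhood[OF W(1,2)]) blast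
  have positive: "eventually (\<lambda>(n, \<omega>). n \<noteq> 0 \<and> \<omega> \<in> space M) (high_prob M)"
    using eventually_obs[of "\<lambda>_. True"] by simp
  have uniform: "eventually (\<lambda>(n, \<omega>). \<forall>\<theta>\<in>\<Theta>.
      dist (sample_mean n (\<lambda>z. \<phi>\<^sub>J z \<theta>) \<omega>) (LINT z|F. \<phi>\<^sub>J z \<theta>) < \<epsilon>) (high_prob M)"
    by (rule uniform_law[OF comp int\<^sub>J cont\<^sub>J dom\<^sub>J \<epsilon>(1)])
  have in_V: "eventually (\<lambda>(n, \<omega>). Z n \<omega> \<in> V) (high_prob M)"
    using uniform positive
  proof eventually_elim
    case (elim x)
    obtain n \<omega> where x: "x = (n, \<omega>)" by (cases x)
    have n: "n \<noteq> 0" and \<omega>: "\<omega> \<in> space M" using elim x by auto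
    have "Z n \<omega> \<in> W"
    proof (rule \<epsilon>(2))
      have "continuous_on \<Theta> (\<lambda>\<theta>. sample_mean n (\<lambda>z. \<phi>\<^sub>J z \<theta>) \<omega>)"
        unfolding sample_mean_def using cont\<^sub>J[OF obs_in_space[OF \<omega>]] by (intro continuous_intros) auto
      then have "continuous_on \<Theta> (Z n \<omega>)" using Z[OF n] by (simp cong: continuous_on_cong)
      moreover have "Z n \<omega> \<in> extensional \<Theta>" by (simp add: Z_eq Z_reg_def)
      ultimately show "Z n \<omega> \<in> mspace (C_space \<Theta>)" using mspace_C_space[OF comp] by simp
      show "dist (Z n \<omega> \<theta>) (\<eta> \<theta>) < \<epsilon>" if "\<theta> \<in> \<Theta>" for \<theta>
        using elim x that by (simp add: Z[OF n] \<eta>)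
    qed
    then show ?case using W(3) x by auto
  qed
  have zero: "eventually (\<lambda>(n, \<omega>). sample_mean n (\<lambda>z. \<phi>\<^sub>J z (S n \<omega>)) \<omega> = 0) (high_prob M)"
    using in_V positive
  proof eventually_elim
    case (elim x)
    obtain n \<omega> where x: "x = (n, \<omega>)" by (cases x)
    have "Z n \<omega> (T (Z n \<omega>)) = 0" "T (Z n \<omega>) \<in> \<Theta>"
      using M_fun elim x unfolding M_functional_def by auto
    then show ?case using elim x Z[of n "S n \<omega>" \<omega>] S_eq by simp
  qed

  obtain U G where U: "open U" "\<theta>\<^sub>0 \<in> U" "integrable F G"
    "AE z in F. \<forall>\<theta>\<in>U \<inter> \<Theta>. \<forall>h. norm (d\<phi>\<^sub>J z \<theta> h) \<le> G z * norm h"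
    using d\<phi>[OF \<theta>\<^sub>0] by blast
  obtain r where r: "r > 0" "ball \<theta>\<^sub>0 r \<subseteq> U \<inter> interior \<Theta>"
    using U(1,2) inner by (meson IntI open_Int open_contains_ball open_interior)
  have ball_\<Theta>: "ball \<theta>\<^sub>0 r \<subseteq> \<Theta>" using r interior_subset by blast
  \<comment> \<open>Interchanging differentiation and expectation identifies \<open>d\<eta>\<close> with the limit of the mean
    derivatives.\<close>
  have d\<eta>: "d\<eta> = (\<lambda>h. LINT z|F. d\<phi>\<^sub>J z \<theta>\<^sub>0 h)"
  proof (rule has_derivative_unique)
    show "(\<eta> has_derivative d\<eta>) (at \<theta>\<^sub>0)" by fact
    have "((\<lambda>\<theta>. LINT z|F. \<phi>\<^sub>J z \<theta>) has_derivative (\<lambda>h. LINT z|F. d\<phi>\<^sub>J z \<theta>\<^sub>0 h)) (at \<theta>\<^sub>0)"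
      using d\<phi>[OF \<theta>\<^sub>0] at_within_interior[OF inner] by auto
    then show "(\<eta> has_derivative (\<lambda>h. LINT z|F. d\<phi>\<^sub>J z \<theta>\<^sub>0 h)) (at \<theta>\<^sub>0)"
      by (rule has_derivative_transform_within_open[OF _ open_ball[of \<theta>\<^sub>0 r]]) (use r ball_\<Theta> \<eta> in auto)
  qed
  have inj: "inj d\<eta>" using \<open>bij d\<eta>\<close> by (rule bij_is_inj)
  have inv: "bounded_linear (inv d\<eta>)" by (rule inj_linear_imp_inv_bounded_linear) fact+
  then obtain K where K: "K > 0" "\<And>y. norm (inv d\<eta> y) \<le> norm y * K" using bounded_linear.pos_bounded by blast
  have tendsto: "((\<lambda>(n, \<omega>). S n \<omega>) \<longlongrightarrow> \<theta>\<^sub>0) (high_prob M)"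
    using root_n by (rule root_n_consistent_tendsto)

  have "null_in_prob M (\<lambda>n \<omega>. sqrt (real n) *\<^sub>R (S n \<omega> - \<theta>\<^sub>0 - (\<Sum>i<n. \<psi> (obs i \<omega>)) /\<^sub>R real n))"
  proof (rule null_in_prob_if_small_relative)
    show "bounded_in_prob M (\<lambda>n \<omega>. sqrt (real n) *\<^sub>R (S n \<omega> - \<theta>\<^sub>0))"
      using root_n by (simp add: root_n_consistent_def)
    fix e :: real assume e: "e > 0"
    obtain \<delta> where \<delta>: "\<delta> > 0" "eventually (\<lambda>(n, \<omega>). \<forall>\<theta>\<in>ball \<theta>\<^sub>0 \<delta>.
      norm (sample_mean n (\<lambda>z. \<phi>\<^sub>J z \<theta>) \<omega> - sample_mean n (\<lambda>z. \<phi>\<^sub>J z \<theta>\<^sub>0) \<omega> - (LINT z|F. d\<phi>\<^sub>J z \<theta>\<^sub>0 (\<theta> - \<theta>\<^sub>0)))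
        \<le> e / K * norm (\<theta> - \<theta>\<^sub>0)) (high_prob M)"
    proof (rule uniform_linearization[OF r(1)])
      show "(\<phi>\<^sub>J z has_derivative d\<phi>\<^sub>J z \<theta>) (at \<theta>)" if "z \<in> space F" "\<theta> \<in> ball \<theta>\<^sub>0 r" for z \<theta>
      proof -
        have "\<theta> \<in> interior \<Theta>" "\<theta> \<in> \<Theta>" using that(2) r(2) ball_\<Theta> by blast+
        then show ?thesis using der[OF that(1), of \<theta>] at_within_interior[of \<theta> \<Theta>] by simp
      qed
      show "integrable F (\<lambda>z. \<phi>\<^sub>J z \<theta>)" if "\<theta> \<in> ball \<theta>\<^sub>0 r" for \<theta> using int\<^sub>J that ball_\<Theta> by blast
      show "integrable F (\<lambda>z. d\<phi>\<^sub>J z \<theta>\<^sub>0 h)" for h using d\<phi>[OF \<theta>\<^sub>0] by blast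
      show "integrable F G" by (rule U(3))
      show "AE z in F. \<forall>\<theta>\<in>ball \<theta>\<^sub>0 r. \<forall>h. norm (d\<phi>\<^sub>J z \<theta> h) \<le> G z * norm h"
        using U(4) by eventually_elim (use r ball_\<Theta> in blast)
      show "e / K > 0" using e K by simp
    qed blast
    show "eventually (\<lambda>(n, \<omega>). norm (sqrt (real n) *\<^sub>R (S n \<omega> - \<theta>\<^sub>0 - (\<Sum>i<n. \<psi> (obs i \<omega>)) /\<^sub>R real n))
        \<le> e * norm (sqrt (real n) *\<^sub>R (S n \<omega> - \<theta>\<^sub>0))) (high_prob M)"
      using \<delta>(2) zero tendstoD[OF tendsto \<delta>(1)]
    proof eventually_elim
      case (elim x)
      obtain n \<omega> where x: "x = (n, \<omega>)" by (cases x)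
      define s where "s = S n \<omega>"
      define m where "m = (\<lambda>\<theta>. sample_mean n (\<lambda>z. \<phi>\<^sub>J z \<theta>) \<omega>)"
      have s: "s \<in> ball \<theta>\<^sub>0 \<delta>" and "m s = 0"
        using elim x by (simp_all add: s_def m_def dist_commute)
      have lin: "norm (m s - m \<theta>\<^sub>0 - d\<eta> (s - \<theta>\<^sub>0)) \<le> e / K * norm (s - \<theta>\<^sub>0)"
        using elim(1) s unfolding x prod.case m_def d\<eta> by blast
      interpret inv: bounded_linear "inv d\<eta>" by (rule inv)
      have "(\<Sum>i<n. \<psi> (obs i \<omega>)) /\<^sub>R real n = - inv d\<eta> (m \<theta>\<^sub>0)"
        by (simp add: \<psi>_def m_def sample_mean_def inv.scaleR inv.sum sum_negf)
      moreover have "s - \<theta>\<^sub>0 = inv d\<eta> (d\<eta> (s - \<theta>\<^sub>0))" using inj by simp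
      \<comment> \<open>The left-hand side is the remainder to be bounded; as \<open>m s = 0\<close>, it is the linearization
        error seen through \<open>inv d\<eta>\<close>.\<close>
      ultimately have "s - \<theta>\<^sub>0 - (\<Sum>i<n. \<psi> (obs i \<omega>)) /\<^sub>R real n = inv d\<eta> (- (m s - m \<theta>\<^sub>0 - d\<eta> (s - \<theta>\<^sub>0)))"
        using \<open>m s = 0\<close> by (simp add: inv.add)
      then have "norm (s - \<theta>\<^sub>0 - (\<Sum>i<n. \<psi> (obs i \<omega>)) /\<^sub>R real n) \<le> norm (m s - m \<theta>\<^sub>0 - d\<eta> (s - \<theta>\<^sub>0)) * K"
        using K(2) by (metis norm_minus_cancel)
      also have "\<dots> \<le> e * norm (s - \<theta>\<^sub>0)" using lin K(1) by (simp add: field_simps)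
      finally have "sqrt n * norm (s - \<theta>\<^sub>0 - (\<Sum>i<n. \<psi> (obs i \<omega>)) /\<^sub>R real n) \<le> sqrt n * (e * norm (s - \<theta>\<^sub>0))"
        by (rule mult_left_mono) simp
      then show ?case by (simp add: x s_def mult.left_commute)
    qed
  qed
  then show ?thesis unfolding asymptotically_linear_def using Psi2 by blast
qed

end
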